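(* Let $\Omega\subset\mathbb{R}^3$ be a connected polyhedral domain and $\varrho>0$. There exists a constant $C>0$ depending only on $\Omega$ and $\varrho$ such that, for every polyhedral mesh $\mathcal{M}_h$ of $\Omega$ with regularity parameter $\varrho$ and every collection $(\alpha_T)_{T\in\mathcal{T}_h}\in\mathbb{R}^{\mathcal{T}_h}$ of values at elements, there is a collection $(\alpha_F)_{F\in\mathcal{F}_h}\in\mathbb{R}^{\mathcal{F}_h}$ of values at faces such that $$\sum_{F\in\mathcal{F}_T}\omega_{TF}\alpha_F=\alpha_T\ \text{ for all }T\in\mathcal{T}_h\quad\text{and}\quad\sum_{T\in\mathcal{T}_h}h_T^{-1}\sum_{F\in\mathcal{F}_T}\alpha_F^2\le C\sum_{T\in\mathcal{T}_h}h_T^{-3}\alpha_T^2.$$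
   Context: **Mesh.** $\Omega\subset\mathbb{R}^3$ is a connected (bounded, open) polyhedral domain. A polyhedral mesh $\mathcal{M}_h=\mathcal{T}_h\cup\mathcal{F}_h\cup\mathcal{E}_h\cup\mathcal{V}_h$ consists of: a finite set $\mathcal{T}_h$ of disjoint open polyhedra (elements) whose closures cover $\overline{\Omega}$; a finite set $\mathcal{F}_h$ of disjoint open planar polygons (faces) such that the boundary of each element is a union of closures of faces, each face lying either on the boundary of exactly two elements or on the boundary of exactly one element and on $\partial\Omega$; the set $\mathcal{E}_h$ of edges (open segments), the boundary of each face being a union of closures of edges; the set $\mathcal{V}_h$ of vertices (endpoints of edges). Elements and faces are topologically trivial (their closures are homeomorphic to closed balls). For $T\in\mathcal{T}_h$, $\mathcal{F}_T$ is the set of faces contained in $\partial T$. $h_Y$ is the diameter of $Y$. Each face $F$ carries a fixed unit normal $\boldsymbol{n}_F$; for $F\in\mathcal{F}_T$, $\omega_{TF}\in\{-1,1\}$ is such that $\omega_{TF}\boldsymbol{n}_F$ points out of $T$. **Mesh regularity.** The mesh has regularity parameter $\varrho>0$ if it admits a matching tetrahedral submesh (a conforming tetrahedral mesh of $\Omega$ such that each tetrahedron lies in a single element and each simplicial face is either disjoint from, or contained in, any given mesh face) such that every tetrahedron $S$ of the submesh has inradius at least $\varrho h_S$ and, if $S\subset T\in\mathcal{T}_h$, $h_S\ge\varrho h_T$. It is assumed that this submesh can be obtained by adding as new vertices only centers of faces and elements of $\mathcal{M}_h$. *)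

theory Defs
  imports "HOL-Analysis.Analysis"
begin

(* Open polyhedra of dimension d, not necessarily convex: the relative interior of a finite union
   of convex polytopes.  Such a set is bounded, relatively open, and equal to the relative interior
   of its closure, so it lies on one side of its boundary (it has no cracks). *)
definition open_polyhedron :: "nat \<Rightarrow> 'a::euclidean_space set \<Rightarrow> bool" where
  "open_polyhedron d P \<longleftrightarrow>
     aff_dim P = int d \<and>
     (\<exists>\<P>. finite \<P> \<and> (\<forall>Q\<in>\<P>. polytope Q) \<and> P = rel_interior (\<Union>\<P>))"

definition polyhedral_domain :: "(real^3) set \<Rightarrow> bool" where
  "polyhedral_domain \<Omega> \<longleftrightarrow> open_polyhedron 3 \<Omega> \<and> connected \<Omega>"

definition element_faces :: "(real^3) set set \<Rightarrow> (real^3) set \<Rightarrow> (real^3) set set" where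
  "element_faces \<F> T = {F\<in>\<F>. F \<subseteq> frontier T}"

locale polyhedral_mesh =
  fixes \<Omega> :: "(real^3) set"
    and \<T> \<F> \<E> :: "(real^3) set set"
    and \<V> :: "(real^3) set"
  assumes finite_elements: "finite \<T>"
    and disjoint_elements: "disjoint \<T>"
    and polyhedron_element: "T \<in> \<T> \<Longrightarrow> open_polyhedron 3 T"
    and element_ball: "T \<in> \<T> \<Longrightarrow> closure T homeomorphic (cball 0 1 :: (real^3) set)"
    and elements_cover: "(\<Union>T\<in>\<T>. closure T) = closure \<Omega>"
    and finite_faces: "finite \<F>"
    and disjoint_faces: "disjoint \<F>"
    and polygon_face: "F \<in> \<F> \<Longrightarrow> open_polyhedron 2 F"
    and face_ball: "F \<in> \<F> \<Longrightarrow> closure F homeomorphic (cball 0 1 :: (real^2) set)"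
    and element_boundary: "T \<in> \<T> \<Longrightarrow> frontier T = (\<Union>F\<in>element_faces \<F> T. closure F)"
    and face_elements: "F \<in> \<F> \<Longrightarrow>
          card {T\<in>\<T>. F \<subseteq> frontier T} = 2 \<or>
          card {T\<in>\<T>. F \<subseteq> frontier T} = 1 \<and> F \<subseteq> frontier \<Omega>"
    and segment_edge: "E \<in> \<E> \<Longrightarrow> \<exists>a b. a \<noteq> b \<and> E = open_segment a b"
    and face_boundary: "F \<in> \<F> \<Longrightarrow>
          rel_frontier F = (\<Union>E\<in>{E\<in>\<E>. E \<subseteq> rel_frontier F}. closure E)"
    and vertices: "\<V> = {a. \<exists>b. a \<noteq> b \<and> open_segment a b \<in> \<E>}"

definition points_out_of :: "real^3 \<Rightarrow> (real^3) set \<Rightarrow> (real^3) set \<Rightarrow> bool" where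
  "points_out_of v T F \<longleftrightarrow>
     (\<forall>x\<in>F. \<exists>e>0. \<forall>t. 0 < t \<and> t < e \<longrightarrow>
        x - t *\<^sub>R v \<in> T \<and> x + t *\<^sub>R v \<notin> closure T)"

locale oriented_polyhedral_mesh = polyhedral_mesh \<Omega> \<T> \<F> \<E> \<V>
  for \<Omega> :: "(real^3) set"
    and \<T> \<F> \<E> :: "(real^3) set set"
    and \<V> :: "(real^3) set" +
  fixes n :: "(real^3) set \<Rightarrow> real^3"
    and \<omega> :: "(real^3) set \<Rightarrow> (real^3) set \<Rightarrow> real"
  assumes unit_normal: "F \<in> \<F> \<Longrightarrow> norm (n F) = 1"
    and normal_orthogonal: "F \<in> \<F> \<Longrightarrow> x \<in> F \<Longrightarrow> y \<in> F \<Longrightarrow> n F \<bullet> (x - y) = 0"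
    and relative_orientation: "T \<in> \<T> \<Longrightarrow> F \<in> element_faces \<F> T \<Longrightarrow> \<omega> T F \<in> {-1, 1}"
    and outward_normal: "T \<in> \<T> \<Longrightarrow> F \<in> element_faces \<F> T \<Longrightarrow>
          points_out_of (\<omega> T F *\<^sub>R n F) T F"

definition inradius :: "'a::euclidean_space set \<Rightarrow> real" where
  "inradius S = Sup {r. 0 \<le> r \<and> (\<exists>x. cball x r \<subseteq> S)}"

(* The tetrahedra S and their facets are closed sets, whereas mesh elements and faces are open;
   hence the interiors below. *)
definition matching_submesh ::
  "(real^3) set \<Rightarrow> (real^3) set set \<Rightarrow> (real^3) set set \<Rightarrow> (real^3) set set \<Rightarrow> bool" where
  "matching_submesh \<Omega> \<T> \<F> \<S> \<longleftrightarrow>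
     triangulation \<S> \<and> (\<forall>S\<in>\<S>. 3 simplex S) \<and> \<Union>\<S> = closure \<Omega> \<and>
     (\<forall>S\<in>\<S>. \<exists>T\<in>\<T>. interior S \<subseteq> T) \<and>
     (\<forall>S\<in>\<S>. \<forall>\<sigma>. \<sigma> facet_of S \<longrightarrow>
        (\<forall>F\<in>\<F>. rel_interior \<sigma> \<inter> F = {} \<or> rel_interior \<sigma> \<subseteq> F))"

(* The center c Y of an element or face Y may be any point of Y. *)
definition regularity_parameter ::
  "real \<Rightarrow> (real^3) set \<Rightarrow> (real^3) set set \<Rightarrow> (real^3) set set \<Rightarrow> (real^3) set \<Rightarrow> bool" where
  "regularity_parameter \<rho> \<Omega> \<T> \<F> \<V> \<longleftrightarrow>
     (\<exists>\<S>. matching_submesh \<Omega> \<T> \<F> \<S> \<and>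
        (\<exists>c. (\<forall>Y\<in>\<T> \<union> \<F>. c Y \<in> Y) \<and>
             (\<exists>\<Y>\<subseteq>\<T> \<union> \<F>. {v. \<exists>S\<in>\<S>. v extreme_point_of S} = \<V> \<union> c ` \<Y>)) \<and>
        (\<forall>S\<in>\<S>. inradius S \<ge> \<rho> * diameter S) \<and>
        (\<forall>S\<in>\<S>. \<forall>T\<in>\<T>. interior S \<subseteq> T \<longrightarrow> diameter S \<ge> \<rho> * diameter T))"

end

theory Submission
  imports Defs
begin

text \<open>
  The idea is to take for \<open>\<beta> F\<close> the flux through the face \<open>F\<close> of a vector field whose divergence has
  integral \<open>\<alpha> T\<close> over every element \<open>T\<close>. If each element \<open>T\<close> carries the uniform source
  density \<open>\<alpha> T / |T|\<close> and each point source radiates equally in all directions, along straight rays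
  to infinity, the result is the gradient field of a Newton potential on the whole space. Such a field
  qualifies because the fluxes through the faces on the boundary of \<open>\<Omega>\<close> are free, and both its
  fluxes and their bounds can be read off from the rays.

  The rays from \<open>x\<close> are \<open>x + t z\<close> with \<open>t > 0\<close> and \<open>z\<close> uniformly distributed in the unit ball. What a
  source at \<open>x\<close> sends through \<open>F\<close> is \<open>ray_flux\<close>, up to a factor the signed solid angle of \<open>F\<close> seen from
  \<open>x\<close>. A ray in general position meets the boundary of an element \<open>T\<close> only in the interior of faces
  and transversally, and the signed count of these crossings telescopes along the ray to 1 if
  \<open>x \<in> T\<close> and to 0 otherwise (\<open>signed_crossings\<close>). Averaging over \<open>z\<close> gives
  Gauss' law (\<open>sum_ray_flux\<close>), and hence the prescribed balance in every element.

  For the energy bound let \<open>\<kappa>(x, F)\<close> be \<open>ray_hits\<close>, up to the same factor the unsigned solid angle, and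
  let \<open>x\<close> range over a ball that contains \<open>\<Omega>\<close>. By the Cauchy-Schwarz inequality for the kernel \<open>\<kappa>\<close>, as in the Schur test, two estimates suffice:

  \<^item> \<open>\<integral> \<kappa>(x, F) dx \<le> C h\<^sub>T\<^sup>2\<close> for every face \<open>F\<close> of \<open>T\<close> (\<open>integral_ray_hits_le\<close>): for a fixed
    direction, the sources whose ray hits \<open>F\<close> lie in a tube of bounded length and thickness \<open>h\<^sub>T\<close>;

  \<^item> \<open>\<Sum>\<^sub>T h\<^sub>T \<Sum>\<^sub>F \<kappa>(x, F) \<le> C\<close> for every \<open>x\<close> (\<open>weighted_ray_hits_le\<close>): the directions that lead into
    \<open>T\<close> form a cone of measure at most \<open>C h\<^sub>T\<^sup>2 / D\<^sub>T\<^sup>2\<close>, where \<open>D\<^sub>T\<close> is \<open>h\<^sub>T\<close> plus the distance from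
    \<open>x\<close> to a point of \<open>T\<close>, and a ray crosses boundedly many faces of \<open>T\<close>. Since \<open>h\<^sub>T\<^sup>3 \<le> C |T|\<close>, the sum is at most a multiple
    of \<open>\<Sum>\<^sub>T |T| / D\<^sub>T\<^sup>2\<close>, which is bounded like the integral of \<open>|x - y|\<^sup>-\<^sup>2\<close> over a large ball
    (\<open>packing_inverse_square_sum\<close>).

  Mesh regularity supplies the last two facts through \<open>regular_element\<close>: the closure of an element is
  a union of at most \<open>8 / \<rho>\<^sup>6\<close> convex sets, and its volume is at least a multiple of the cube of its diameter.
\<close>

section \<open>Volumes of tubes, cones and packings\<close>

lemma measure_cball_3: "0 \<le> r \<Longrightarrow> measure lborel (cball (c::real^3) r) = 4/3 * pi * r ^ 3"
  by (simp add: content_cball unit_ball_vol_3)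

lemma fmeasurable_cball: "cball (c::'a::euclidean_space) r \<in> fmeasurable lborel"
  using emeasure_bounded_finite[of "cball c r"] by (intro fmeasurableI) (auto simp: less_top)

text \<open>
  A tube of radius \<open>r\<close> is covered by about \<open>L / r\<close> balls of radius \<open>2 r\<close> centred on its axis of length
  \<open>L\<close>. Covering it avoids rotating the tube into a coordinate direction.
\<close>
lemma thickened_segment_cover:
  fixes a b :: "real^3"
  assumes "0 < r"
  obtains W where "W \<in> fmeasurable lborel"
    and "{p. \<exists>q\<in>closed_segment a b. dist q p \<le> r} \<subseteq> W"
    and "measure lborel W \<le> 32 * pi * r\<^sup>2 * (dist a b + r)"
proof -
  define L where "L = dist a b"
  \<comment> \<open>The \<open>m + 1 \<le> 3 (L + r) / r\<close> centres below have distance at most \<open>r\<close> from their neighbours.\<close>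
  define m where "m = nat \<lceil>L / r\<rceil> + 1"
  have L0: "0 \<le> L" by (simp add: L_def)
  have m_ge: "L / r \<le> real m" and m_le: "real m \<le> L / r + 2" and m_pos: "0 < real m"
  proof -
    have "0 \<le> \<lceil>L / r\<rceil>" using L0 assms by (simp add: order_trans[OF _ le_of_int_ceiling] ceiling_mono[of 0, simplified])
    then have "real m = of_int \<lceil>L / r\<rceil> + 1" by (simp add: m_def)
    then show "L / r \<le> real m" "real m \<le> L / r + 2" by linarith+
    show "0 < real m" by (simp add: m_def)
  qed
  define q where "q i = a + (real i / real m) *\<^sub>R (b - a)" for i :: nat
  define W where "W = (\<Union>i\<in>{0..m}. cball (q i) (2 * r))"
  show thesis
  proof
    show "W \<in> fmeasurable lborel"
      unfolding W_def by (intro fmeasurable.finite_UN fmeasurable_cball) auto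
    show "{p. \<exists>q\<in>closed_segment a b. dist q p \<le> r} \<subseteq> W"
    proof clarify
      fix p q' assume q': "q' \<in> closed_segment a b" and p: "dist q' p \<le> r"
      obtain s where s: "0 \<le> s" "s \<le> 1" and q's: "q' = a + s *\<^sub>R (b - a)"
        using q' by (auto simp: in_segment algebra_simps)
      define i where "i = nat \<lfloor>s * real m\<rfloor>"
      have sm: "0 \<le> s * real m" "s * real m \<le> real m"
        using s m_pos by (auto simp: mult_left_le_one_le)
      have i1: "real i \<le> s * real m" and i2: "s * real m \<le> real i + 1"
        using sm unfolding i_def by (auto simp: of_nat_nat)
      have i3: "i \<le> m" using i1 sm by linarith
      have "\<bar>s - real i / real m\<bar> \<le> 1 / real m"
      proof -
        have "s - real i / real m = (s * real m - real i) / real m"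
          using m_pos by (simp add: field_simps)
        moreover have "\<bar>s * real m - real i\<bar> \<le> 1" using i1 i2 by linarith
        ultimately show ?thesis using m_pos by (simp add: divide_right_mono)
      qed
      moreover have "dist (q i) q' = \<bar>s - real i / real m\<bar> * L"
      proof -
        have "q' - q i = (s - real i / real m) *\<^sub>R (b - a)"
          by (simp add: q's q_def algebra_simps)
        then show ?thesis by (simp add: L_def dist_norm norm_minus_commute)
      qed
      ultimately have "dist (q i) q' \<le> 1 / real m * L"
        using L0 by (metis mult_right_mono)
      also have "\<dots> \<le> r" using m_ge m_pos assms by (simp add: field_simps)
      finally have "dist (q i) p \<le> 2 * r" using p dist_triangle[of "q i" p q'] by linarith
      then show "p \<in> W" using i3 unfolding W_def by auto
    qed
    have "measure lborel W \<le> (\<Sum>i\<in>{0..m}. measure lborel (cball (q i) (2 * r)))"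
      unfolding W_def by (intro measure_UNION_le) auto
    also have "\<dots> = real (m + 1) * (4/3 * pi * (2 * r) ^ 3)"
      using assms by (simp add: measure_cball_3)
    also have "\<dots> \<le> (3 * (L + r) / r) * (4/3 * pi * (2 * r) ^ 3)"
    proof (rule mult_right_mono)
      have "real (m + 1) \<le> L / r + 3" using m_le by simp
      also have "\<dots> \<le> 3 * (L + r) / r" using assms L0 by (simp add: field_simps)
      finally show "real (m + 1) \<le> 3 * (L + r) / r" .
    qed (use assms in auto)
    also have "\<dots> = 32 * pi * r\<^sup>2 * (L + r)"
      using assms by (simp add: field_simps power2_eq_square power3_eq_cube)
    finally show "measure lborel W \<le> 32 * pi * r\<^sup>2 * (dist a b + r)" by (simp add: L_def)
  qed
qed

text \<open>
  From afar, a ray that comes within \<open>h\<close> of \<open>y\<close> needs a parameter \<open>t\<close> of at least half the distance \<open>d\<close>.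
  Rescaling by \<open>1 / t\<close> puts its direction within \<open>2 h / d\<close> of a segment of length 2 that points towards
  \<open>y\<close>. From close by, the right-hand side exceeds the volume of the unit ball.
\<close>
lemma cone_of_directions_cover:
  fixes x y :: "real^3"
  assumes "0 < h"
  obtains W where "W \<in> fmeasurable lborel"
    and "{z\<in>cball 0 1. \<exists>t\<ge>0. dist (x + t *\<^sub>R z) y \<le> h} \<subseteq> W"
    and "measure lborel W \<le> 864 * pi * (h / (dist x y + h))\<^sup>2"
proof (cases "dist x y \<le> 2 * h")
  case True
  have "1/3 \<le> h / (dist x y + h)" using True assms zero_le_dist[of x y]
    by (subst le_divide_eq) (auto simp: add_nonneg_pos)
  then have "(1/3)\<^sup>2 \<le> (h / (dist x y + h))\<^sup>2" by (intro power_mono) auto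
  then have "864 * pi * (1/3)\<^sup>2 \<le> 864 * pi * (h / (dist x y + h))\<^sup>2"
    by (intro mult_left_mono) auto
  moreover have "4/3 * pi \<le> 864 * pi * (1/3)\<^sup>2" using pi_gt_zero by (simp add: power2_eq_square)
  ultimately have "4/3 * pi \<le> 864 * pi * (h / (dist x y + h))\<^sup>2" by linarith
  then show thesis
    by (intro that[of "cball 0 1"] fmeasurable_cball) (auto simp: measure_cball_3)
next
  case False
  define d where "d = dist x y"
  have d: "2 * h < d" using False by (simp add: d_def)
  have d0: "0 < d" using d assms by simp
  define r where "r = 2 * h / d"
  have r: "0 < r" "r \<le> 1" using d d0 assms by (auto simp: r_def field_simps)
  obtain W where W: "W \<in> fmeasurable lborel"
    "{p. \<exists>q\<in>closed_segment 0 ((2/d) *\<^sub>R (y - x)). dist q p \<le> r} \<subseteq> W"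
    "measure lborel W \<le> 32 * pi * r\<^sup>2 * (dist 0 ((2/d) *\<^sub>R (y - x)) + r)"
    using thickened_segment_cover[OF r(1)] by blast
  show thesis
  proof
    show "W \<in> fmeasurable lborel" by fact
    have "dist 0 ((2/d) *\<^sub>R (y - x)) = 2" using d0 by (simp add: d_def dist_norm norm_minus_commute)
    then have "measure lborel W \<le> 32 * pi * r\<^sup>2 * (2 + r)" using W(3) by simp
    also have "\<dots> \<le> 32 * pi * r\<^sup>2 * 3" by (intro mult_left_mono) (use r in auto)
    also have "\<dots> = 384 * pi * (h / d)\<^sup>2" by (simp add: r_def power_divide power_mult_distrib)
    also have "\<dots> \<le> 384 * pi * (3/2 * (h / (d + h)))\<^sup>2"
    proof (intro mult_left_mono power_mono)
      show "h / d \<le> 3/2 * (h / (d + h))" using d d0 assms by (simp add: field_simps)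
    qed (use assms d0 in auto)
    also have "\<dots> = 864 * pi * (h / (d + h))\<^sup>2"
    proof -
      have "(3/2 * X)\<^sup>2 = 9/4 * X\<^sup>2" for X :: real by (simp add: power2_eq_square)
      then show ?thesis by (simp only:)
    qed
    finally show "measure lborel W \<le> 864 * pi * (h / (dist x y + h))\<^sup>2" by (simp add: d_def)
    show "{z\<in>cball 0 1. \<exists>t\<ge>0. dist (x + t *\<^sub>R z) y \<le> h} \<subseteq> W"
    proof (clarsimp)
      fix z :: "real^3" and t :: real
      assume z: "norm z \<le> 1" and t: "0 \<le> t" and h: "dist (x + t *\<^sub>R z) y \<le> h"
      have "d \<le> dist x (x + t *\<^sub>R z) + h"
        unfolding d_def using dist_triangle[of x y "x + t *\<^sub>R z"] h by linarith
      also have "dist x (x + t *\<^sub>R z) = t * norm z" using t by (simp add: dist_norm)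
      also have "t * norm z \<le> t" using z t by (simp add: mult_left_le)
      finally have t2: "d / 2 < t" using d by linarith
      then have t0: "0 < t" using d0 by linarith
      have "dist ((1/t) *\<^sub>R (y - x)) z = dist (x + t *\<^sub>R z) y / t"
      proof -
        have "(1/t) *\<^sub>R (y - x) - z = (1/t) *\<^sub>R (y - (x + t *\<^sub>R z))"
          using t0 by (simp add: algebra_simps)
        then show ?thesis using t0 by (simp add: dist_norm norm_minus_commute)
      qed
      also have "\<dots> \<le> h / (d / 2)" using t2 h d0 assms by (intro frac_le) auto
      also have "\<dots> = r" by (simp add: r_def)
      finally have 1: "dist ((1/t) *\<^sub>R (y - x)) z \<le> r" .
      have "(1/t) *\<^sub>R (y - x) \<in> closed_segment 0 ((2/d) *\<^sub>R (y - x))"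
        unfolding in_segment using t2 t0 d0
        by (intro exI[of _ "d / (2 * t)"]) (auto simp: field_simps)
      with 1 show "z \<in> W" using W(2) by blast
    qed
  qed
qed

text \<open>
  This replaces the integral of \<open>|x - y|\<^sup>-\<^sup>2\<close> over a ball. Writing \<open>1 / D\<^sup>2\<close> as an integral of \<open>2 / t\<^sup>3\<close>
  over \<open>t \<ge> D\<close> turns the sum into an integral over \<open>t\<close> of \<open>2 / t\<^sup>3\<close> times the volume of those sets that
  lie in the ball of radius \<open>t\<close>, and disjointness bounds that volume by a multiple of \<open>t\<^sup>3\<close>.
\<close>
lemma packing_inverse_square_sum:
  fixes x :: "real^3" and D :: "'i \<Rightarrow> real" and A :: "'i \<Rightarrow> (real^3) set"
  assumes fin: "finite I" and meas: "\<And>i. i \<in> I \<Longrightarrow> A i \<in> sets lborel"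
    and disj: "disjoint_family_on A I"
    and D: "\<And>i. i \<in> I \<Longrightarrow> 0 < D i" "\<And>i. i \<in> I \<Longrightarrow> D i \<le> R"
    and sub: "\<And>i. i \<in> I \<Longrightarrow> A i \<subseteq> cball x (D i)"
    and R: "0 < R"
  shows "(\<Sum>i\<in>I. measure lborel (A i) / (D i)\<^sup>2) \<le> 8 * pi * R"
proof -
  have fm: "A i \<in> fmeasurable lborel" if "i \<in> I" for i
    using fmeasurableI2[OF fmeasurable_cball sub meas] that by blast
  define \<phi> where "\<phi> i t = (if D i \<le> t then 2 / t ^ 3 else 0)" for i and t :: real
  \<comment> \<open>Stopping at \<open>2 R\<close>, beyond all \<open>D i\<close>, keeps at least three quarters of \<open>1 / (D i)\<^sup>2\<close>.\<close>
  have int: "(\<phi> i has_integral (1 / (D i)\<^sup>2 - 1 / (2 * R)\<^sup>2)) {0..2*R}" if "i \<in> I" for i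
  proof -
    have "((\<lambda>t. 2 / t ^ 3) has_integral (- (1 / (2 * R)\<^sup>2) - - (1 / (D i)\<^sup>2))) {D i..2*R}"
    proof (rule fundamental_theorem_of_calculus)
      show "D i \<le> 2 * R" using D(2)[OF that] R by linarith
      fix t assume "t \<in> {D i..2 * R}"
      then have "t > 0" using D(1)[OF that] by auto
      then have "((\<lambda>t. - (1 / t\<^sup>2)) has_real_derivative 2 / t ^ 3) (at t within {D i..2 * R})"
        by (auto intro!: derivative_eq_intros simp: field_simps power2_eq_square power3_eq_cube)
      then show "((\<lambda>t. - (1 / t\<^sup>2)) has_vector_derivative 2 / t ^ 3) (at t within {D i..2 * R})"
        by (simp add: has_real_derivative_iff_has_vector_derivative)
    qed
    then have "((\<lambda>t. if t \<in> {D i..2*R} then 2 / t ^ 3 else 0) has_integral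
        (1 / (D i)\<^sup>2 - 1 / (2 * R)\<^sup>2)) {0..2*R}"
      using D(1)[OF that] by (subst has_integral_restrict) auto
    then show ?thesis
      by (rule has_integral_eq[rotated]) (auto simp: \<phi>_def)
  qed
  have "((\<lambda>t. \<Sum>i\<in>I. measure lborel (A i) * \<phi> i t) has_integral
      (\<Sum>i\<in>I. measure lborel (A i) * (1 / (D i)\<^sup>2 - 1 / (2 * R)\<^sup>2))) {0..2*R}"
    by (intro has_integral_sum fin has_integral_mult_right int)
  moreover have "((\<lambda>t::real. 8/3 * pi) has_integral (2 * R) * (8/3 * pi)) {0..2*R}"
    using has_integral_const_real[of "8/3 * pi" 0 "2 * R"] R by simp
  ultimately have "(\<Sum>i\<in>I. measure lborel (A i) * (1 / (D i)\<^sup>2 - 1 / (2 * R)\<^sup>2)) \<le> (2 * R) * (8/3 * pi)"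
  proof (rule has_integral_le)
    fix t assume "t \<in> {0..2 * R}"
    show "(\<Sum>i\<in>I. measure lborel (A i) * \<phi> i t) \<le> 8/3 * pi"
    proof (cases "t = 0")
      case True
      then have "\<phi> i t = 0" for i by (simp add: \<phi>_def)
      then show ?thesis by simp
    next
      case False
      then have t: "t > 0" using \<open>t \<in> _\<close> by auto
      define J where "J = {i\<in>I. D i \<le> t}"
      have J: "finite J" "J \<subseteq> I" using fin by (auto simp: J_def)
      have "(\<Sum>i\<in>J. measure lborel (A i)) = measure lborel (\<Union>i\<in>J. A i)"
        using J disj fm
        by (intro measure_UNION'[symmetric])
          (auto simp: disjoint_family_on_def pairwise_def disjnt_def subset_iff)
      also have "\<dots> \<le> measure lborel (cball x t)"
      proof (rule measure_mono_fmeasurable)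
        show "(\<Union>i\<in>J. A i) \<subseteq> cball x t" using sub by (fastforce simp: J_def)
        show "(\<Union>i\<in>J. A i) \<in> sets lborel" using J meas by (intro sets.finite_UN) auto
      qed (rule fmeasurable_cball)
      also have "\<dots> = 4/3 * pi * t ^ 3" using t by (simp add: measure_cball_3)
      finally have *: "(\<Sum>i\<in>J. measure lborel (A i)) \<le> 4/3 * pi * t ^ 3" .
      have "(\<Sum>i\<in>I. measure lborel (A i) * \<phi> i t) = (\<Sum>i\<in>J. measure lborel (A i) * (2 / t ^ 3))"
        unfolding J_def \<phi>_def by (subst sum.inter_filter[OF fin]) (auto intro!: sum.cong)
      also have "\<dots> = (\<Sum>i\<in>J. measure lborel (A i)) * (2 / t ^ 3)" by (rule sum_distrib_right[symmetric])
      also have "\<dots> \<le> (4/3 * pi * t ^ 3) * (2 / t ^ 3)" using * t by (intro mult_right_mono) auto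
      also have "\<dots> = 8/3 * pi" using t by simp
      finally show ?thesis .
    qed
  qed
  moreover have "(\<Sum>i\<in>I. measure lborel (A i) / (D i)\<^sup>2) * (3/4) \<le>
      (\<Sum>i\<in>I. measure lborel (A i) * (1 / (D i)\<^sup>2 - 1 / (2 * R)\<^sup>2))"
    unfolding sum_distrib_right
  proof (rule sum_mono)
    fix i assume i: "i \<in> I"
    have "(1 / (2 * R))\<^sup>2 \<le> (1 / (2 * D i))\<^sup>2"
      using D(1,2)[OF i] by (intro power_mono frac_le) auto
    then have "1 / (D i)\<^sup>2 * (3/4) \<le> 1 / (D i)\<^sup>2 - 1 / (2 * R)\<^sup>2"
      by (simp add: power_divide power_mult_distrib)
    then have "measure lborel (A i) * (1 / (D i)\<^sup>2 * (3/4)) \<le> measure lborel (A i) * (1 / (D i)\<^sup>2 - 1 / (2 * R)\<^sup>2)"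
      by (rule mult_left_mono) simp
    then show "measure lborel (A i) / (D i)\<^sup>2 * (3/4) \<le> measure lborel (A i) * (1 / (D i)\<^sup>2 - 1 / (2 * R)\<^sup>2)"
      by simp
  qed
  ultimately have "(\<Sum>i\<in>I. measure lborel (A i) / (D i)\<^sup>2) * (3/4) \<le> (2 * R) * (8/3 * pi)" by linarith
  also have "\<dots> \<le> 8 * pi * R * (3/4)" by (simp add: R less_imp_le)
  finally show ?thesis by (simp add: mult_ac)
qed

section \<open>Polyhedra and null sets of directions\<close>

lemma open_polyhedron_3:
  assumes "open_polyhedron 3 (T :: (real^3) set)"
  shows "open T" "bounded T" "T \<noteq> {}"
proof -
  obtain \<P> where fin: "finite \<P>" and poly: "\<And>Q. Q \<in> \<P> \<Longrightarrow> polytope Q"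
    and T: "T = rel_interior (\<Union>\<P>)" and dim: "aff_dim T = 3"
    using assms by (auto simp: open_polyhedron_def)
  have "aff_dim T \<le> aff_dim (\<Union>\<P>)" unfolding T by (intro aff_dim_subset rel_interior_subset)
  then have "aff_dim (\<Union>\<P>) = DIM(real^3)" using dim aff_dim_le_DIM[of "\<Union>\<P>"] by simp
  then have "T = interior (\<Union>\<P>)" unfolding T aff_dim_eq_full by (rule rel_interior_interior)
  then show "open T" by simp
  have "bounded (\<Union>\<P>)" using fin poly by (auto intro: polytope_imp_bounded)
  then show "bounded T" unfolding T by (rule bounded_subset) (rule rel_interior_subset)
  show "T \<noteq> {}" using dim by auto
qed

lemma open_polyhedron_openin_affine_hull:
  assumes "open_polyhedron d (P :: 'a::euclidean_space set)"
  shows "openin (top_of_set (affine hull P)) P"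
proof -
  obtain U where P: "P = rel_interior U" and "P \<noteq> {}"
    using assms by (force simp: open_polyhedron_def)
  have "openin (top_of_set (affine hull U)) P" unfolding P by (rule openin_rel_interior)
  moreover from this have "affine hull P = affine hull U"
    using \<open>P \<noteq> {}\<close> by (rule affine_hull_openin)
  ultimately show ?thesis by simp
qed

lemma open_polyhedron_borel:
  assumes "open_polyhedron d (P :: 'a::euclidean_space set)"
  shows "P \<in> sets borel"
proof -
  obtain V where "open V" "P = affine hull P \<inter> V"
    using open_polyhedron_openin_affine_hull[OF assms] unfolding openin_open by blast
  moreover have "affine hull P \<in> sets borel" by (intro borel_closed closed_affine_hull)
  ultimately show ?thesis by (metis borel_open sets.Int)
qed

text \<open>
  A boundary point lies in one of the polytopes, and if that polytope has full dimension then on one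
  of its facets, because its relative interior is contained in that of the union.
\<close>
lemma open_polyhedron_boundary_cover:
  assumes "open_polyhedron (Suc d) (P :: 'a::euclidean_space set)"
  obtains \<G> where "finite \<G>" "\<forall>G\<in>\<G>. aff_dim G \<le> int d" "closure P - P \<subseteq> \<Union>\<G>"
proof -
  obtain \<P> where fin: "finite \<P>" and poly: "\<And>Q. Q \<in> \<P> \<Longrightarrow> polytope Q"
    and P: "P = rel_interior (\<Union>\<P>)" and dim: "aff_dim P = 1 + int d"
    using assms by (auto simp: open_polyhedron_def)
  define U where "U = \<Union>\<P>"
  have "P \<noteq> {}" using dim by auto
  then have hull: "affine hull P = affine hull U"
    unfolding P U_def by (intro affine_hull_openin openin_rel_interior)
  then have dimU: "aff_dim U = 1 + int d" using dim aff_dim_affine_hull by metis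
  define \<G> where "\<G> = {Q\<in>\<P>. aff_dim Q \<le> int d} \<union> (\<Union>Q\<in>\<P>. {G. G facet_of Q})"
  show thesis
  proof
    show "finite \<G>" unfolding \<G>_def using fin poly by (auto intro: finite_polytope_facets)
    show "\<forall>G\<in>\<G>. aff_dim G \<le> int d"
    proof
      fix G assume G: "G \<in> \<G>"
      have "aff_dim Q \<le> 1 + int d" if "Q \<in> \<P>" for Q
        using aff_dim_subset[of Q U] that dimU by (auto simp: U_def)
      then show "aff_dim G \<le> int d" using G by (fastforce simp: \<G>_def facet_of_def)
    qed
    show "closure P - P \<subseteq> \<Union>\<G>"
    proof
      fix y assume y: "y \<in> closure P - P"
      have "closed U" unfolding U_def using fin poly by (auto intro: polytope_imp_closed)
      then have "closure P \<subseteq> U"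
        unfolding P U_def[symmetric] by (intro closure_minimal rel_interior_subset)
      then obtain Q where Q: "Q \<in> \<P>" "y \<in> Q" using y by (auto simp: U_def)
      show "y \<in> \<Union>\<G>"
      proof (cases "aff_dim Q \<le> int d")
        case True
        then show ?thesis using Q by (auto simp: \<G>_def)
      next
        case False
        have QU: "Q \<subseteq> U" using Q by (auto simp: U_def)
        have "aff_dim (affine hull Q) = aff_dim (affine hull U)"
          using False aff_dim_subset[OF QU] dimU by simp
        then have "affine hull Q = affine hull U"
          using Q QU by (intro affine_dim_equal hull_mono) auto
        then have "rel_interior Q \<subseteq> P"
          unfolding P U_def[symmetric] by (intro subset_rel_interior QU)
        then have "y \<in> rel_frontier Q"
          using y Q poly[OF Q(1)] by (auto simp: rel_frontier_def closure_closed polytope_imp_closed)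
        then have "y \<in> \<Union>{G. G facet_of Q}"
          using rel_frontier_of_polyhedron polytope_imp_polyhedron poly[OF Q(1)] by blast
        then show ?thesis using Q by (auto simp: \<G>_def)
      qed
    qed
  qed
qed

text \<open>
  The directions from \<open>x\<close> into a set of affine dimension at most 1 span at most a plane.
\<close>
lemma negligible_rays_through_segment:
  fixes x :: "real^3"
  assumes "aff_dim G \<le> 1"
  shows "negligible {z. \<exists>t>0. x + t *\<^sub>R z \<in> G}"
proof -
  define H where "H = (+) (- x) ` insert x G"
  have "aff_dim H \<le> 2"
    using assms aff_dim_insert[of x G] unfolding H_def aff_dim_translation_eq by (auto split: if_splits)
  moreover have "0 \<in> affine hull H" by (rule hull_inc) (auto simp: H_def)
  ultimately have "dim H \<le> 2" by (simp add: aff_dim_zero)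
  then have "negligible (span H)" by (intro negligible_lowdim) (simp add: dim_span)
  moreover have "{z. \<exists>t>0. x + t *\<^sub>R z \<in> G} \<subseteq> span H"
  proof clarify
    fix z and t :: real assume t: "t > 0" "x + t *\<^sub>R z \<in> G"
    then have "t *\<^sub>R z \<in> H" by (auto simp: H_def image_iff intro!: bexI[of _ "x + t *\<^sub>R z"])
    then have "(1/t) *\<^sub>R (t *\<^sub>R z) \<in> span H" by (intro span_mul span_base)
    then show "z \<in> span H" using t by simp
  qed
  ultimately show ?thesis by (rule negligible_subset)
qed

lemma AE_lborel_not_in_negligible:
  assumes "negligible N" shows "AE z in lborel. z \<notin> N"
proof -
  have "AE z in lebesgue. z \<notin> N"
    using assms by (intro AE_not_in) (simp add: negligible_iff_null_sets)
  then show ?thesis by (simp add: AE_completion_iff)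
qed

section \<open>Crossing the boundary of an element along a line\<close>

text \<open>
  The two open half-balls at \<open>y\<close> are connected and miss the frontier of \<open>T\<close>, so each of them lies on
  one side of it. Hence what is known along the normal \<open>v\<close> holds along every transversal line.
\<close>
lemma line_crosses_flat_frontier:
  fixes T :: "'a::euclidean_space set"
  assumes "0 < r" and flat: "ball y r \<inter> frontier T \<subseteq> {q. v \<bullet> (q - y) = 0}"
    and v: "norm v = 1" and "0 < e"
    and sides: "\<And>t. 0 < t \<Longrightarrow> t < e \<Longrightarrow> y - t *\<^sub>R v \<in> T \<and> y + t *\<^sub>R v \<notin> closure T"
  obtains d where "0 < d"
    and "\<And>s. \<bar>s\<bar> < d \<Longrightarrow> s * (v \<bullet> z) < 0 \<Longrightarrow> y + s *\<^sub>R z \<in> T"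
    and "\<And>s. \<bar>s\<bar> < d \<Longrightarrow> s * (v \<bullet> z) > 0 \<Longrightarrow> y + s *\<^sub>R z \<notin> closure T"
proof -
  define H where "H = ball y r \<inter> {q. v \<bullet> (q - y) < 0}"
  define K where "K = ball y r \<inter> {q. v \<bullet> (q - y) > 0}"
  define t where "t = min e r / 2"
  have t: "0 < t" "t < e" "t < r" using assms by (auto simp: t_def)
  have vv: "v \<bullet> v = 1" using v by (simp add: norm_eq_1)
  have eqH: "{q. v \<bullet> (q - y) < 0} = {q. v \<bullet> q < v \<bullet> y}"
    and eqK: "{q. v \<bullet> (q - y) > 0} = {q. v \<bullet> q > v \<bullet> y}" by (auto simp: inner_diff_right)
  have conn: "connected H" "connected K"
    unfolding H_def K_def eqH eqK
    by (intro convex_connected convex_Int convex_ball convex_halfspace_lt convex_halfspace_gt)+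
  have tH: "y - t *\<^sub>R v \<in> H" using t v vv by (simp add: H_def dist_norm inner_diff_right)
  have tK: "y + t *\<^sub>R v \<in> K" using t v vv by (simp add: K_def dist_norm inner_diff_right inner_add_right)
  have HT: "H \<subseteq> T"
  proof (rule ccontr)
    assume "\<not> H \<subseteq> T"
    then have "H \<inter> frontier T \<noteq> {}"
      using conn tH sides[OF t(1,2)] by (intro connected_Int_frontier) auto
    then show False using flat by (auto simp: H_def)
  qed
  have KT: "K \<inter> closure T = {}"
  proof (rule ccontr)
    assume "K \<inter> closure T \<noteq> {}"
    then have "K \<inter> frontier (closure T) \<noteq> {}"
      using conn tK sides[OF t(1,2)] by (intro connected_Int_frontier) auto
    then have "K \<inter> frontier T \<noteq> {}" using interior_mono[OF closure_subset[of T]] by (auto simp: frontier_def)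
    then show False using flat by (auto simp: K_def)
  qed
  show thesis
  proof
    show "0 < r / (norm z + 1)" using \<open>0 < r\<close> by (simp add: add_nonneg_pos)
    have in_ball: "y + s *\<^sub>R z \<in> ball y r" if "\<bar>s\<bar> < r / (norm z + 1)" for s
    proof -
      have "\<bar>s\<bar> * norm z \<le> \<bar>s\<bar> * (norm z + 1)" by (intro mult_left_mono) auto
      also have "\<dots> < r" using that by (simp add: pos_less_divide_eq add_nonneg_pos)
      finally show ?thesis by (simp add: dist_norm)
    qed
    show "y + s *\<^sub>R z \<in> T" if "\<bar>s\<bar> < r / (norm z + 1)" "s * (v \<bullet> z) < 0" for s
      using in_ball[OF that(1)] that(2) HT by (auto simp: H_def)
    show "y + s *\<^sub>R z \<notin> closure T" if "\<bar>s\<bar> < r / (norm z + 1)" "s * (v \<bullet> z) > 0" for s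
      using in_ball[OF that(1)] that(2) KT by (auto simp: K_def)
  qed
qed

text \<open>
  A function that is locally constant off a finite set changes by the sum of its jumps. Connectedness
  of the interval spreads the identity \<open>Q t\<close> from \<open>a\<close> to \<open>b\<close> through the points outside \<open>J\<close>: near any
  point \<open>c\<close> at most one jump, that at \<open>c\<close> itself, is added to the sum, and it equals the change of \<open>f\<close> there.
\<close>
lemma telescoping_jumps:
  fixes f s :: "real \<Rightarrow> real"
  assumes "finite J" "a \<le> b" "a \<notin> J" "b \<notin> J"
    and cont: "\<And>t. a \<le> t \<Longrightarrow> t \<le> b \<Longrightarrow> t \<notin> J \<Longrightarrow> \<exists>e>0. \<forall>u. \<bar>u - t\<bar> < e \<longrightarrow> f u = f t"
    and jump: "\<And>t. t \<in> J \<Longrightarrow> \<exists>e>0. \<forall>u w. t - e < u \<longrightarrow> u < t \<longrightarrow> t < w \<longrightarrow> w < t + e \<longrightarrow> f u - f w = s t"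
  shows "(\<Sum>t\<in>J \<inter> {a..b}. s t) = f a - f b"
proof -
  define Q where "Q t \<longleftrightarrow> (\<Sum>u\<in>J \<inter> {a..t}. s u) = f a - f t" for t
  have "Q b"
  proof (rule connected_induction[where S = "{a..b}" and P = "\<lambda>t. t \<notin> J" and Q = Q and a = a])
    fix T and c :: real
    assume T: "openin (top_of_set {a..b}) T" "c \<in> T"
    have sub: "T \<subseteq> {a..b}" using openin_imp_subset[OF T(1)] .
    show "\<exists>z. z \<in> T \<and> z \<notin> J"
    proof (cases "a = b")
      case True
      then have "c = a" using T(2) sub by auto
      then show ?thesis using T(2) assms(3) by auto
    next
      case False
      have "c \<in> {a..b}" using T(2) sub by (rule rev_subsetD)
      then have "c islimpt {a..b}" using False assms(2)
        by (intro connected_imp_perfect) auto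
      moreover obtain V where "open V" "T = {a..b} \<inter> V" using T unfolding openin_open by blast
      ultimately have "infinite T" using T(2) by (simp add: islimpt_eq_acc_point Int_commute)
      then show ?thesis using assms(1) finite_subset[of T J] by blast
    qed
  next
    fix c assume c: "c \<in> {a..b}"
    obtain e1 where e1: "e1 > 0" and "\<forall>u\<in>J. u \<noteq> c \<longrightarrow> e1 \<le> dist c u"
      using finite_set_avoid[OF assms(1), of c] by metis
    then have e1': "e1 \<le> \<bar>u - c\<bar>" if "u \<in> J" "u \<noteq> c" for u
      using that by (metis dist_real_def dist_commute)
    \<comment> \<open>Between points near \<open>c\<close>, \<open>f\<close> changes only if \<open>c\<close> is a jump that separates them.\<close>
  have "\<exists>e2>0. \<forall>x y. \<bar>x - c\<bar> < e2 \<longrightarrow> \<bar>y - c\<bar> < e2 \<longrightarrow> x \<notin> J \<longrightarrow> y \<notin> J \<longrightarrow>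
        f x - f y = (if x < c \<and> c < y \<and> c \<in> J then s c else if y < c \<and> c < x \<and> c \<in> J then - s c else 0)"
    proof (cases "c \<in> J")
      case False
      have "a \<le> c" "c \<le> b" using c by auto
      from cont[OF this False] obtain e where e: "e > 0 \<and> (\<forall>u. \<bar>u - c\<bar> < e \<longrightarrow> f u = f c)" by (rule exE)
      show ?thesis
      proof (intro exI[of _ e] conjI allI impI)
        fix x y assume near: "\<bar>x - c\<bar> < e" "\<bar>y - c\<bar> < e"
        have "f x = f c" by (rule conjunct2[OF e, rule_format, OF near(1)])
        moreover have "f y = f c" by (rule conjunct2[OF e, rule_format, OF near(2)])
        ultimately show "f x - f y = (if x < c \<and> c < y \<and> c \<in> J then s c else if y < c \<and> c < x \<and> c \<in> J then - s c else 0)"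
          using False by simp
      qed (rule conjunct1[OF e])
    next
      case True
      from jump[OF True] obtain e where e_both: "e > 0 \<and> (\<forall>u w. c - e < u \<longrightarrow> u < c \<longrightarrow> c < w \<longrightarrow> w < c + e \<longrightarrow> f u - f w = s c)"
        by (rule exE)
      note e0 = conjunct1[OF e_both] and e = conjunct2[OF e_both]
      have m: "c - e < c - e/2" "c - e/2 < c" "c < c + e/2" "c + e/2 < c + e" using e0 by auto
      have L: "f u = s c + f (c + e/2)" if "c - e < u" "u < c" for u
        using e[rule_format, OF that m(3,4)] by linarith
      have R: "f w = f (c - e/2) - s c" if "c < w" "w < c + e" for w
        using e[rule_format, OF m(1,2) that] by linarith
      show ?thesis
      proof (intro exI[of _ e] conjI allI impI)
        fix x y assume xy: "\<bar>x - c\<bar> < e" "\<bar>y - c\<bar> < e" "x \<notin> J" "y \<notin> J"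
        then have "x \<noteq> c" "y \<noteq> c" using True by auto
        then consider "x < c" "y < c" | "x < c" "c < y" | "c < x" "y < c" | "c < x" "c < y"
          by linarith
        then show "f x - f y = (if x < c \<and> c < y \<and> c \<in> J then s c else if y < c \<and> c < x \<and> c \<in> J then - s c else 0)"
        proof cases
          case 1 then show ?thesis using L[of x] L[of y] xy True by (simp add: abs_less_iff)
        next
          case 2 then show ?thesis using e[rule_format, of x y] xy True by (simp add: abs_less_iff)
        next
          case 3 then show ?thesis using e[rule_format, of y x] xy True by (simp add: abs_less_iff)
        next
          case 4 then show ?thesis using R[of x] R[of y] xy True by (simp add: abs_less_iff)
        qed
      qed (rule e0)
    qed
    then obtain e2 where e2: "e2 > 0" "\<And>x y. \<bar>x - c\<bar> < e2 \<Longrightarrow> \<bar>y - c\<bar> < e2 \<Longrightarrow> x \<notin> J \<Longrightarrow> y \<notin> J \<Longrightarrow>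
        f x - f y = (if x < c \<and> c < y \<and> c \<in> J then s c else if y < c \<and> c < x \<and> c \<in> J then - s c else 0)"
      by metis
    define e where "e = min e1 e2"
    define T where "T = {a..b} \<inter> ball c e"
    have J_near: "u = c" if "u \<in> J" "\<bar>u - c\<bar> < e" for u using e1'[of u] that by (cases "u = c") (auto simp: e_def)
    show "\<exists>T. openin (top_of_set {a..b}) T \<and> c \<in> T \<and> (\<forall>x\<in>T. \<forall>y\<in>T. x \<notin> J \<and> y \<notin> J \<and> Q x \<longrightarrow> Q y)"
    proof (intro exI[of _ T] conjI ballI impI)
      show "openin (top_of_set {a..b}) T" unfolding T_def by (simp add: openin_open_Int)
      show "c \<in> T" using c e1 e2 by (simp add: T_def e_def)
      fix x y assume xy: "x \<in> T" "y \<in> T" and as: "x \<notin> J \<and> y \<notin> J \<and> Q x"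
      have d: "\<bar>x - c\<bar> < e" "\<bar>y - c\<bar> < e" and ab: "a \<le> x" "a \<le> y"
        using xy by (auto simp: T_def dist_real_def)
      have fxy: "f x - f y = (if x < c \<and> c < y \<and> c \<in> J then s c else if y < c \<and> c < x \<and> c \<in> J then - s c else 0)"
        using e2(2)[of x y] d as unfolding e_def by auto
      have "u \<le> x \<longleftrightarrow> u \<le> y" if "u \<in> J" "u \<noteq> c" for u
      proof -
        have "\<not> \<bar>u - c\<bar> < e" using J_near that by blast
        then show ?thesis using d by linarith
      qed
      then have J_eq: "J \<inter> {a..x} - {c} = J \<inter> {a..y} - {c}" using as by auto
      define \<sigma> where "\<sigma> t = (\<Sum>u\<in>J \<inter> {a..t}. s u)" for t
      have \<sigma>: "\<sigma> t = (\<Sum>u\<in>J \<inter> {a..t} - {c}. s u) + (if c \<in> J \<and> c \<le> t then s c else 0)" for t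
        using assms(1) c sum.remove[of "J \<inter> {a..t}" c s] unfolding \<sigma>_def
        by (cases "c \<in> J \<inter> {a..t}") auto
      have "x \<noteq> c \<and> y \<noteq> c \<or> c \<notin> J" using as by blast
      then have "\<sigma> y - \<sigma> x = f x - f y" unfolding \<sigma> J_eq fxy by (auto)
      moreover have "\<sigma> x = f a - f x" using as by (simp add: Q_def \<sigma>_def)
      ultimately show "Q y" by (simp add: Q_def \<sigma>_def)
    qed
  next
    have "J \<inter> {a..a} = {}" using assms(3) by auto
    then show "Q a" by (simp add: Q_def)
  qed (use assms(2-4) in auto)
  then show ?thesis by (simp add: Q_def)
qed

text \<open>
  The crossing number of the ray from \<open>x\<close> in direction \<open>z\<close> with a set \<open>F\<close> in a plane normal to \<open>v\<close>. A ray
  parallel to the plane gets the value 0, since then \<open>sgn (v \<bullet> z)\<close> vanishes.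
\<close>
definition ray_sign :: "real^3 \<Rightarrow> (real^3) set \<Rightarrow> real^3 \<Rightarrow> real^3 \<Rightarrow> real" where
  "ray_sign v F x z = (if \<exists>t>0. x + t *\<^sub>R z \<in> F then sgn (v \<bullet> z) else 0)"

text \<open>
  Almost all directions are of this kind. Since faces are relatively open, \<open>closure F - F\<close> is the relative
  boundary of \<open>F\<close>; keeping clear of it means that near every hit the boundary of an element is flat.
\<close>
definition generic_direction ::
  "((real^3) set \<Rightarrow> real^3) \<Rightarrow> (real^3) set set \<Rightarrow> real^3 \<Rightarrow> real^3 \<Rightarrow> bool" where
  "generic_direction n \<F> x z \<longleftrightarrow>
     z \<noteq> 0 \<and> (\<forall>F\<in>\<F>. n F \<bullet> z \<noteq> 0 \<and> (\<forall>t>0. x + t *\<^sub>R z \<notin> closure F - F))"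

context oriented_polyhedral_mesh
begin

lemma AE_generic_direction: "AE z in lborel. generic_direction n \<F> x z"
proof -
  have 1: "negligible {z. n F \<bullet> z = 0}" if "F \<in> \<F>" for F
    using unit_normal[OF that] by (intro negligible_hyperplane) auto
  have 2: "negligible {z. \<exists>t>0. x + t *\<^sub>R z \<in> closure F - F}" if F: "F \<in> \<F>" for F
  proof -
    have "open_polyhedron (Suc 1) F" using polygon_face[OF F] by (simp add: numeral_2_eq_2)
    then obtain \<G> where \<G>: "finite \<G>" "\<forall>G\<in>\<G>. aff_dim G \<le> int 1" "closure F - F \<subseteq> \<Union>\<G>"
      by (rule open_polyhedron_boundary_cover)
    have "negligible (\<Union>G\<in>\<G>. {z. \<exists>t>0. x + t *\<^sub>R z \<in> G})"
    proof (intro negligible_Union finite_imageI \<G>(1))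
      fix N assume "N \<in> (\<lambda>G. {z. \<exists>t>0. x + t *\<^sub>R z \<in> G}) ` \<G>"
      then show "negligible N" using negligible_rays_through_segment \<G>(2) by auto
    qed
    then show ?thesis by (rule negligible_subset) (use \<G>(3) in blast)
  qed
  have "negligible ({0} \<union> (\<Union>F\<in>\<F>. {z. n F \<bullet> z = 0} \<union> {z. \<exists>t>0. x + t *\<^sub>R z \<in> closure F - F}))"
    using finite_faces 1 2 by (intro negligible_Un negligible_Union) auto
  from AE_lborel_not_in_negligible[OF this] show ?thesis
    by (rule AE_mp) (auto simp: generic_direction_def)
qed

lemma hit_time_unique:
  assumes "generic_direction n \<F> x z" "F \<in> \<F>" "x + t *\<^sub>R z \<in> F" "x + u *\<^sub>R z \<in> F"
  shows "t = u"
proof -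
  have "n F \<bullet> ((x + t *\<^sub>R z) - (x + u *\<^sub>R z)) = 0" using assms by (intro normal_orthogonal)
  then have "(t - u) * (n F \<bullet> z) = 0" by (simp add: algebra_simps inner_diff_right inner_add_right)
  then show ?thesis using assms by (auto simp: generic_direction_def)
qed

lemma hit_face_unique: "F \<in> \<F> \<Longrightarrow> G \<in> \<F> \<Longrightarrow> y \<in> F \<Longrightarrow> y \<in> G \<Longrightarrow> F = G"
  using disjoint_faces by (auto simp: disjoint_def)

lemma frontier_hit_in_face:
  assumes "generic_direction n \<F> x z" "T \<in> \<T>" "0 < t" "x + t *\<^sub>R z \<in> frontier T"
  obtains F where "F \<in> element_faces \<F> T" "x + t *\<^sub>R z \<in> F"
proof -
  obtain F where F: "F \<in> element_faces \<F> T" "x + t *\<^sub>R z \<in> closure F"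
    using assms(4) unfolding element_boundary[OF assms(2)] by blast
  then have "x + t *\<^sub>R z \<in> F"
    using assms(1,3) unfolding generic_direction_def element_faces_def by blast
  with F(1) show thesis by (rule that)
qed

text \<open>
  In a generic direction, a point where the ray meets \<open>F\<close> is away from the closures of all other faces
  of \<open>T\<close>, so the frontier of \<open>T\<close> is flat there.
\<close>
lemma crossing_at_hit:
  assumes gen: "generic_direction n \<F> x z" and T: "T \<in> \<T>" and F: "F \<in> element_faces \<F> T"
    and t: "0 < t" "x + t *\<^sub>R z \<in> F"
  obtains d where "0 < d"
    and "\<And>u. \<bar>u - t\<bar> < d \<Longrightarrow> (u - t) * (\<omega> T F * (n F \<bullet> z)) < 0 \<Longrightarrow> x + u *\<^sub>R z \<in> T"
    and "\<And>u. \<bar>u - t\<bar> < d \<Longrightarrow> (u - t) * (\<omega> T F * (n F \<bullet> z)) > 0 \<Longrightarrow> x + u *\<^sub>R z \<notin> closure T"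
proof -
  define y where "y = x + t *\<^sub>R z"
  define v where "v = \<omega> T F *\<^sub>R n F"
  have F': "F \<in> \<F>" using F by (simp add: element_faces_def)
  define A where "A = (\<Union>G\<in>element_faces \<F> T - {F}. closure G)"
  have "closed A" unfolding A_def using finite_faces by (auto simp: element_faces_def)
  moreover have "y \<notin> A"
  proof
    assume "y \<in> A"
    then obtain G where G: "G \<in> \<F>" "G \<noteq> F" "y \<in> closure G" by (auto simp: A_def element_faces_def)
    then have "y \<in> G" using gen t(1) by (auto simp: generic_direction_def y_def)
    then show False using hit_face_unique[OF F' G(1)] t(2) G(2) by (simp add: y_def)
  qed
  ultimately obtain r where r: "0 < r" "ball y r \<subseteq> - A"
    by (metis Compl_iff open_Compl open_contains_ball)
  have cl: "closure F \<subseteq> {q. v \<bullet> (q - y) = 0}"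
  proof (rule closure_minimal)
    show "F \<subseteq> {q. v \<bullet> (q - y) = 0}"
      using normal_orthogonal[OF F' _ t(2)] by (auto simp: v_def y_def)
    have "{q. v \<bullet> (q - y) = 0} = {q. v \<bullet> q = v \<bullet> y}" by (auto simp: inner_diff_right)
    then show "closed {q. v \<bullet> (q - y) = 0}" by (simp add: closed_hyperplane)
  qed
  have "ball y r \<inter> frontier T \<subseteq> closure F"
    using r(2) element_boundary[OF T] F by (auto simp: A_def)
  then have flat: "ball y r \<inter> frontier T \<subseteq> {q. v \<bullet> (q - y) = 0}" using cl by blast
  have nv: "norm v = 1"
    using unit_normal[OF F'] relative_orientation[OF T F] by (auto simp: v_def)
  have "points_out_of v T F" unfolding v_def by (rule outward_normal[OF T F])
  then obtain e where e: "e > 0" "\<And>t. 0 < t \<Longrightarrow> t < e \<Longrightarrow> y - t *\<^sub>R v \<in> T \<and> y + t *\<^sub>R v \<notin> closure T"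
    using t(2) unfolding points_out_of_def y_def[symmetric] by blast
  obtain d where d: "0 < d" "\<And>s. \<bar>s\<bar> < d \<Longrightarrow> s * (v \<bullet> z) < 0 \<Longrightarrow> y + s *\<^sub>R z \<in> T"
    "\<And>s. \<bar>s\<bar> < d \<Longrightarrow> s * (v \<bullet> z) > 0 \<Longrightarrow> y + s *\<^sub>R z \<notin> closure T"
    using line_crosses_flat_frontier[OF r(1) flat nv e, of z] by blast
  have y_eq: "y + (u - t) *\<^sub>R z = x + u *\<^sub>R z" for u by (simp add: y_def algebra_simps)
  have vz: "v \<bullet> z = \<omega> T F * (n F \<bullet> z)" by (simp add: v_def)
  show thesis
    using that[OF d(1)] d(2)[of "_ - t", unfolded y_eq vz] d(3)[of "_ - t", unfolded y_eq vz] by blast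
qed

text \<open>
  Along the ray, membership in \<open>T\<close> jumps exactly at the hits, by the sign of the crossing. It starts
  with the membership of \<open>x\<close> and ends with that of points far away.
\<close>
lemma signed_crossings:
  assumes gen: "generic_direction n \<F> x z" and T: "T \<in> \<T>" and x: "x \<notin> frontier T"
  shows "(\<Sum>F\<in>element_faces \<F> T. \<omega> T F * ray_sign (n F) F x z) = of_bool (x \<in> T)"
proof -
  define H where "H = {F\<in>element_faces \<F> T. \<exists>t>0. x + t *\<^sub>R z \<in> F}"
  have finH: "finite H" using finite_faces by (simp add: H_def element_faces_def)
  have HF: "F \<in> \<F>" if "F \<in> H" for F using that by (simp add: H_def element_faces_def)
  have "\<forall>F\<in>H. \<exists>t>0. x + t *\<^sub>R z \<in> F" by (auto simp: H_def)
  then obtain \<tau> where \<tau>: "\<And>F. F \<in> H \<Longrightarrow> 0 < \<tau> F" "\<And>F. F \<in> H \<Longrightarrow> x + \<tau> F *\<^sub>R z \<in> F" by metis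
  have inj: "inj_on \<tau> H"
  proof (rule inj_onI)
    fix F G assume "F \<in> H" "G \<in> H" "\<tau> F = \<tau> G"
    then show "F = G" using \<tau>(2)[of F] \<tau>(2)[of G] HF by (metis hit_face_unique)
  qed
  define g where "g F = sgn (\<omega> T F * (n F \<bullet> z))" for F
  define s where "s t = g (inv_into H \<tau> t)" for t
  define f where "f t = (of_bool (x + t *\<^sub>R z \<in> T) :: real)" for t
  define J where "J = \<tau> ` H"
  have frontier_J: "x + t *\<^sub>R z \<notin> frontier T" if "0 \<le> t" "t \<notin> J" for t
  proof (cases "t = 0")
    case False
    then have "0 < t" using that(1) by simp
    show ?thesis
    proof
      assume "x + t *\<^sub>R z \<in> frontier T"
      then obtain F where F: "F \<in> element_faces \<F> T" "x + t *\<^sub>R z \<in> F"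
        by (rule frontier_hit_in_face[OF gen T \<open>0 < t\<close>])
      then have "F \<in> H" using \<open>0 < t\<close> by (auto simp: H_def)
      moreover from this have "\<tau> F = t" using hit_time_unique[OF gen HF \<tau>(2) F(2)] by simp
      ultimately show False using that by (auto simp: J_def)
    qed
  qed (use x in simp)
  have opT: "open T" and bdT: "bounded T" using open_polyhedron_3[OF polyhedron_element[OF T]] by auto
  have z0: "z \<noteq> 0" using gen by (simp add: generic_direction_def)
  obtain B where B: "\<And>y. y \<in> closure T \<Longrightarrow> norm y \<le> B"
    using bdT bounded_closure bounded_iff by metis
  \<comment> \<open>Beyond the parameter \<open>b\<close> the ray has left the ball of radius \<open>B\<close> around 0, which contains \<open>T\<close>.\<close>
  define b where "b = (\<bar>B\<bar> + norm x) / norm z + 1"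
  have b0: "b > 0" using z0 by (simp add: b_def add_nonneg_pos)
  have far: "x + t *\<^sub>R z \<notin> closure T" if "b \<le> t" for t
  proof
    assume "x + t *\<^sub>R z \<in> closure T"
    then have "norm (x + t *\<^sub>R z) \<le> B" by (rule B)
    moreover have "\<bar>t\<bar> * norm z \<le> norm (x + t *\<^sub>R z) + norm x"
      using norm_triangle_ineq4[of "x + t *\<^sub>R z" x] by simp
    moreover have "b * norm z \<le> \<bar>t\<bar> * norm z" using that by (intro mult_right_mono) auto
    moreover have "b * norm z = \<bar>B\<bar> + norm x + norm z" using z0 by (simp add: b_def field_simps)
    ultimately show False using z0 zero_less_norm_iff[of z] by linarith
  qed
  have cl: "x + \<tau> F *\<^sub>R z \<in> closure T" if "F \<in> H" for F
    using \<tau>(2)[OF that] that by (auto simp: H_def element_faces_def frontier_def)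
  have "0 < \<tau> F \<and> \<tau> F < b" if "F \<in> H" for F
    using \<tau>(1)[OF that] cl[OF that] far[of "\<tau> F"] by force
  then have J_sub: "J \<subseteq> {0..b}" and "0 \<notin> J" "b \<notin> J"
    unfolding J_def by fastforce+
  have "(\<Sum>t\<in>J \<inter> {0..b}. s t) = f 0 - f b"
  proof (rule telescoping_jumps)
    show "finite J" using finH by (simp add: J_def)
    fix t assume t: "0 \<le> t" "t \<notin> J"
    have "open ((\<lambda>u. x + u *\<^sub>R z) -` T)" "open ((\<lambda>u. x + u *\<^sub>R z) -` (- closure T))"
      using opT by (auto intro!: continuous_open_vimage continuous_intros)
    moreover have "t \<in> (\<lambda>u. x + u *\<^sub>R z) -` T \<or> t \<in> (\<lambda>u. x + u *\<^sub>R z) -` (- closure T)"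
      using frontier_J[OF t] opT by (auto simp: frontier_def interior_open)
    moreover have "f u = f t" if "x + u *\<^sub>R z \<in> T" "x + t *\<^sub>R z \<in> T" for u
      using that by (simp add: f_def)
    moreover have "f u = f t" if "x + u *\<^sub>R z \<in> - closure T" "x + t *\<^sub>R z \<in> - closure T" for u
      using that closure_subset[of T] by (auto simp: f_def)
    ultimately show "\<exists>e>0. \<forall>u. \<bar>u - t\<bar> < e \<longrightarrow> f u = f t"
      unfolding open_dist dist_real_def by (metis vimage_eq)
  next
    fix t assume "t \<in> J"
    then obtain F where F: "F \<in> H" "t = \<tau> F" by (auto simp: J_def)
    have st: "s t = sgn (\<omega> T F * (n F \<bullet> z))" using F inj by (simp add: s_def g_def)
    have F': "F \<in> element_faces \<F> T" using F by (simp add: H_def)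
    obtain d where d: "0 < d"
      "\<And>u. \<bar>u - t\<bar> < d \<Longrightarrow> (u - t) * (\<omega> T F * (n F \<bullet> z)) < 0 \<Longrightarrow> x + u *\<^sub>R z \<in> T"
      "\<And>u. \<bar>u - t\<bar> < d \<Longrightarrow> (u - t) * (\<omega> T F * (n F \<bullet> z)) > 0 \<Longrightarrow> x + u *\<^sub>R z \<notin> closure T"
      using crossing_at_hit[OF gen T F'] \<tau>[OF F(1)] F(2) by metis
    show "\<exists>e>0. \<forall>u w. t - e < u \<longrightarrow> u < t \<longrightarrow> t < w \<longrightarrow> w < t + e \<longrightarrow> f u - f w = s t"
    proof (intro exI[of _ d] conjI allI impI d(1))
      fix u w assume uw: "t - d < u" "u < t" "t < w" "w < t + d"
      then have near: "\<bar>u - t\<bar> < d" "\<bar>w - t\<bar> < d" and sgns: "u - t < 0" "w - t > 0" by auto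
      show "f u - f w = s t"
      proof (cases "\<omega> T F * (n F \<bullet> z) > 0")
        case True
        then have "x + u *\<^sub>R z \<in> T" "x + w *\<^sub>R z \<notin> T"
          using d(2)[OF near(1)] d(3)[OF near(2)] sgns closure_subset[of T]
          by (auto simp: mult_neg_pos)
        then show ?thesis using True unfolding st by (simp add: f_def)
      next
        case False
        moreover have "\<omega> T F * (n F \<bullet> z) \<noteq> 0"
          using gen HF[OF F(1)] relative_orientation[OF T F'] by (auto simp: generic_direction_def)
        ultimately have neg: "\<omega> T F * (n F \<bullet> z) < 0" by linarith
        then have "x + u *\<^sub>R z \<notin> T" "x + w *\<^sub>R z \<in> T"
          using d(3)[OF near(1)] d(2)[OF near(2)] sgns closure_subset[of T]
          by (auto simp: mult_neg_neg mult_pos_neg)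
        then show ?thesis using neg unfolding st by (simp add: f_def)
      qed
    qed
  qed (use b0 \<open>0 \<notin> J\<close> \<open>b \<notin> J\<close> in auto)
  also have "J \<inter> {0..b} = J" using J_sub by auto
  also have "(\<Sum>t\<in>J. s t) = (\<Sum>F\<in>H. g F)"
    unfolding J_def using inj by (simp add: sum.reindex s_def)
  also have "f 0 - f b = of_bool (x \<in> T)" using far[of b] closure_subset[of T] by (auto simp: f_def)
  finally have "(\<Sum>F\<in>H. g F) = of_bool (x \<in> T)" .
  moreover have "(\<Sum>F\<in>element_faces \<F> T. \<omega> T F * ray_sign (n F) F x z) = (\<Sum>F\<in>H. g F)"
  proof (rule sum.mono_neutral_cong_right)
    show "finite (element_faces \<F> T)" using finite_faces by (simp add: element_faces_def)
    show "H \<subseteq> element_faces \<F> T" by (auto simp: H_def)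
    show "\<forall>F\<in>element_faces \<F> T - H. \<omega> T F * ray_sign (n F) F x z = 0"
      by (auto simp: H_def ray_sign_def)
    show "\<omega> T F * ray_sign (n F) F x z = g F" if "F \<in> H" for F
      using that relative_orientation[OF T, of F] by (auto simp: H_def ray_sign_def g_def sgn_mult)
  qed
  ultimately show ?thesis by simp
qed

text \<open>
  Where the ray leaves \<open>T\<close>, it reaches the end of the interval in which it meets some \<open>S \<in> \<S>\<close>, because
  \<open>S\<close> is convex and contained in the closure of \<open>T\<close>; where it enters, it is at the start of such an
  interval. Thus each member of \<open>\<S>\<close> accounts for at most one exit and one entry.
\<close>
lemma card_crossed_faces_le:
  assumes gen: "generic_direction n \<F> x z" and T: "T \<in> \<T>"
    and fin: "finite \<S>" and conv: "\<And>S. S \<in> \<S> \<Longrightarrow> convex S" and cover: "closure T = \<Union>\<S>"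
  shows "card {F\<in>element_faces \<F> T. \<exists>t>0. x + t *\<^sub>R z \<in> F} \<le> 2 * card \<S>"
proof -
  define H where "H = {F\<in>element_faces \<F> T. \<exists>t>0. x + t *\<^sub>R z \<in> F}"
  have finH: "finite H" using finite_faces by (simp add: H_def element_faces_def)
  have HF: "F \<in> \<F>" if "F \<in> H" for F using that by (simp add: H_def element_faces_def)
  have "\<forall>F\<in>H. \<exists>t>0. x + t *\<^sub>R z \<in> F" by (auto simp: H_def)
  then obtain \<tau> where \<tau>: "\<And>F. F \<in> H \<Longrightarrow> 0 < \<tau> F" "\<And>F. F \<in> H \<Longrightarrow> x + \<tau> F *\<^sub>R z \<in> F" by metis
  have "\<exists>S\<in>\<S>. x + \<tau> F *\<^sub>R z \<in> S" if "F \<in> H" for F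
    using \<tau>(2)[OF that] that cover by (auto simp: H_def element_faces_def frontier_def)
  then obtain \<sigma> where \<sigma>: "\<And>F. F \<in> H \<Longrightarrow> \<sigma> F \<in> \<S>" "\<And>F. F \<in> H \<Longrightarrow> x + \<tau> F *\<^sub>R z \<in> \<sigma> F" by metis
  have \<tau>_inj: "F = G" if "F \<in> H" "G \<in> H" "\<tau> F = \<tau> G" for F G
    using that \<tau>(2)[of F] \<tau>(2)[of G] HF hit_face_unique by metis
  have between: "x + u *\<^sub>R z \<in> closure T"
    if "F \<in> H" "G \<in> H" "\<sigma> F = \<sigma> G" "\<tau> F \<le> u" "u \<le> \<tau> G" for F G u
  proof (cases "\<tau> F = \<tau> G")
    case True
    then have "u = \<tau> F" using that by simp
    then show ?thesis using \<sigma> that cover by blast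
  next
    case False
    then have lt: "\<tau> F < \<tau> G" using that by linarith
    define \<theta> where "\<theta> = (u - \<tau> F) / (\<tau> G - \<tau> F)"
    have \<theta>: "0 \<le> \<theta>" "\<theta> \<le> 1" using lt that by (auto simp: \<theta>_def field_simps)
    have "x + u *\<^sub>R z = (1 - \<theta>) *\<^sub>R (x + \<tau> F *\<^sub>R z) + \<theta> *\<^sub>R (x + \<tau> G *\<^sub>R z)"
    proof -
      have "u = (1 - \<theta>) * \<tau> F + \<theta> * \<tau> G" 
      proof -
        have "\<theta> * (\<tau> G - \<tau> F) = u - \<tau> F" using lt by (simp add: \<theta>_def)
        then show ?thesis by (simp add: algebra_simps)
      qed
      then show ?thesis by (simp only:) (simp add: algebra_simps)
    qed
    moreover have "\<dots> \<in> \<sigma> F"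
      using \<sigma>[OF that(1)] \<sigma>[OF that(2)] that(3) \<theta> conv by (intro convexD_alt) auto
    ultimately show ?thesis using \<sigma>(1)[OF that(1)] cover by auto
  qed
  have sign: "\<omega> T F * (n F \<bullet> z) \<noteq> 0" if "F \<in> H" for F
    using that gen relative_orientation[OF T, of F]
    by (auto simp: generic_direction_def H_def element_faces_def)
  \<comment> \<open>The faces through which the ray leaves \<open>T\<close>, and those through which it enters.\<close>
  define E where "E = {F\<in>H. \<omega> T F * (n F \<bullet> z) > 0}"
  define N where "N = {F\<in>H. \<omega> T F * (n F \<bullet> z) < 0}"
  have "\<omega> T F * (n F \<bullet> z) > 0 \<or> \<omega> T F * (n F \<bullet> z) < 0" if "F \<in> H" for F
    using sign[OF that] by linarith
  then have "H = E \<union> N" by (auto simp: E_def N_def)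
  have no_exit: "\<not> \<tau> F < \<tau> G" if "F \<in> E" "G \<in> H" "\<sigma> F = \<sigma> G" for F G
  proof
    assume lt: "\<tau> F < \<tau> G"
    have F: "F \<in> H" "F \<in> element_faces \<F> T" "\<omega> T F * (n F \<bullet> z) > 0" using that by (auto simp: E_def H_def)
    obtain d where d: "0 < d"
      "\<And>u. \<bar>u - \<tau> F\<bar> < d \<Longrightarrow> (u - \<tau> F) * (\<omega> T F * (n F \<bullet> z)) > 0 \<Longrightarrow> x + u *\<^sub>R z \<notin> closure T"
      using crossing_at_hit[OF gen T F(2) \<tau>[OF F(1)]] by metis
    define u where "u = \<tau> F + min (d/2) (\<tau> G - \<tau> F)"
    have "\<bar>u - \<tau> F\<bar> < d" "u - \<tau> F > 0" "u \<le> \<tau> G" using d(1) lt by (auto simp: u_def)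
    then show False using d(2)[of u] between[of F G u] that F by simp
  qed
  have no_entry: "\<not> \<tau> G < \<tau> F" if "F \<in> N" "G \<in> H" "\<sigma> F = \<sigma> G" for F G
  proof
    assume lt: "\<tau> G < \<tau> F"
    have F: "F \<in> H" "F \<in> element_faces \<F> T" "\<omega> T F * (n F \<bullet> z) < 0" using that by (auto simp: N_def H_def)
    obtain d where d: "0 < d"
      "\<And>u. \<bar>u - \<tau> F\<bar> < d \<Longrightarrow> (u - \<tau> F) * (\<omega> T F * (n F \<bullet> z)) > 0 \<Longrightarrow> x + u *\<^sub>R z \<notin> closure T"
      using crossing_at_hit[OF gen T F(2) \<tau>[OF F(1)]] by metis
    define u where "u = \<tau> F - min (d/2) (\<tau> F - \<tau> G)"
    have "\<bar>u - \<tau> F\<bar> < d" "u - \<tau> F < 0" "\<tau> G \<le> u" "u \<le> \<tau> F" using d(1) lt by (auto simp: u_def)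
    then show False using d(2)[of u] between[of G F u] that F by (simp add: mult_neg_neg)
  qed
  have "inj_on \<sigma> E"
  proof (rule inj_onI)
    fix F G assume FG: "F \<in> E" "G \<in> E" "\<sigma> F = \<sigma> G"
    then have "F \<in> H" "G \<in> H" by (auto simp: E_def)
    with no_exit[of F G] no_exit[of G F] FG have "\<tau> F = \<tau> G" by simp
    with \<open>F \<in> H\<close> \<open>G \<in> H\<close> show "F = G" by (rule \<tau>_inj)
  qed
  then have 1: "card E \<le> card \<S>" using \<sigma>(1) fin by (intro card_inj_on_le[of \<sigma>]) (auto simp: E_def)
  have "inj_on \<sigma> N"
  proof (rule inj_onI)
    fix F G assume FG: "F \<in> N" "G \<in> N" "\<sigma> F = \<sigma> G"
    then have "F \<in> H" "G \<in> H" by (auto simp: N_def)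
    with no_entry[of F G] no_entry[of G F] FG have "\<tau> F = \<tau> G" by simp
    with \<open>F \<in> H\<close> \<open>G \<in> H\<close> show "F = G" by (rule \<tau>_inj)
  qed
  then have 2: "card N \<le> card \<S>" using \<sigma>(1) fin by (intro card_inj_on_le[of \<sigma>]) (auto simp: N_def)
  have "card H \<le> card E + card N" unfolding \<open>H = E \<union> N\<close> by (rule card_Un_le)
  then show ?thesis using 1 2 by (simp add: H_def)
qed

end

section \<open>Solid angles of planar sets\<close>

text \<open>
  A third of the signed solid angle of \<open>F\<close> seen from \<open>x\<close>: the flux through \<open>F\<close> of the field
  \<open>(y - x) / (3 |y - x|\<^sup>3)\<close>. Averaging over the unit ball instead of the unit sphere leaves only Lebesgue
  measure to work with.
\<close>
definition ray_flux :: "real^3 \<Rightarrow> (real^3) set \<Rightarrow> real^3 \<Rightarrow> real" where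
  "ray_flux v F x = (LINT z|lborel. indicator (cball 0 1) z * ray_sign v F x z)"

definition ray_hits :: "real^3 \<Rightarrow> (real^3) set \<Rightarrow> real^3 \<Rightarrow> real" where
  "ray_hits v F x = (LINT z|lborel. indicator (cball 0 1) z * \<bar>ray_sign v F x z\<bar>)"

lemma abs_ray_sign_le: "\<bar>ray_sign v F x z\<bar> \<le> 1"
  by (simp add: ray_sign_def sgn_real_def)

lemma integrable_bounded_support:
  fixes f :: "'a \<Rightarrow> real"
  assumes "f \<in> borel_measurable M" "W \<in> fmeasurable M" "\<And>x. x \<in> space M \<Longrightarrow> \<bar>f x\<bar> \<le> c * indicator W x"
  shows "integrable M f"
proof (rule Bochner_Integration.integrable_bound)
  show "integrable M (\<lambda>x. c * indicator W x)"
    using assms(2) by (intro integrable_mult_right integrable_real_indicator) (auto simp: fmeasurable_def)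
  show "AE x in M. norm (f x) \<le> norm (c * indicator W x :: real)"
    using assms(3) by (intro AE_I2) force
qed (use assms in auto)

text \<open>
  The only parameter at which a transversal ray can hit \<open>F\<close> is \<open>(c - v \<bullet> x) / (v \<bullet> z)\<close>, which removes
  the existential quantifier.
\<close>
lemma ray_sign_measurable:
  assumes F: "F \<in> sets borel" and plane: "F \<subseteq> {y. v \<bullet> y = c}"
  shows "case_prod (ray_sign v F) \<in> borel_measurable (lborel \<Otimes>\<^sub>M lborel)"
proof -
  define \<tau> where "\<tau> p = (c - v \<bullet> fst p) / (v \<bullet> snd p)" for p :: "(real^3) \<times> (real^3)"
  have eq: "ray_sign v F x z = sgn (v \<bullet> z) *
      (indicator {0<..} (\<tau> (x, z)) * indicator F (x + \<tau> (x, z) *\<^sub>R z))" for x z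
  proof (cases "v \<bullet> z = 0")
    case False
    have "t = \<tau> (x, z)" if "x + t *\<^sub>R z \<in> F" for t
    proof -
      have "v \<bullet> (x + t *\<^sub>R z) = c" using that plane by blast
      then show ?thesis using False by (simp add: \<tau>_def field_simps inner_add_right)
    qed
    then have "(\<exists>t>0. x + t *\<^sub>R z \<in> F) \<longleftrightarrow> \<tau> (x, z) > 0 \<and> x + \<tau> (x, z) *\<^sub>R z \<in> F" by metis
    then show ?thesis by (auto simp: ray_sign_def indicator_def)
  qed (simp add: ray_sign_def)
  have \<tau>[measurable]: "\<tau> \<in> borel_measurable (borel \<Otimes>\<^sub>M borel)"
    unfolding \<tau>_def by measurable
  have [measurable]: "F \<in> sets borel" by (rule F)
  have "(\<lambda>p. sgn (v \<bullet> snd p) *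
      (indicator {0<..} (\<tau> p) * indicator F (fst p + \<tau> p *\<^sub>R snd p) :: real))
    \<in> borel_measurable (borel \<Otimes>\<^sub>M borel)"
    by measurable
  moreover have "case_prod (ray_sign v F) = (\<lambda>p. sgn (v \<bullet> snd p) *
      (indicator {0<..} (\<tau> p) * indicator F (fst p + \<tau> p *\<^sub>R snd p)))"
    by (auto simp: eq)
  ultimately show ?thesis
    by (simp add: measurable_cong_sets[OF sets_pair_measure_cong[OF sets_lborel sets_lborel] refl])
qed

context
  fixes v :: "real^3" and F :: "(real^3) set" and c :: real
  assumes F: "F \<in> sets borel" and plane: "F \<subseteq> {y. v \<bullet> y = c}"
begin

lemma ray_sign_measurable_direction: "ray_sign v F x \<in> borel_measurable lborel"
proof -
  have "(\<lambda>z. case_prod (ray_sign v F) (x, z)) \<in> borel_measurable lborel"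
    by (rule measurable_compose[OF _ ray_sign_measurable[OF F plane]]) auto
  then show ?thesis by simp
qed

lemma integrable_ray_sign:
  "integrable lborel (\<lambda>z. indicator (cball 0 1) z * ray_sign v F x z)"
  "integrable lborel (\<lambda>z. indicator (cball 0 1) z * \<bar>ray_sign v F x z\<bar>)"
  using ray_sign_measurable_direction[of x] abs_ray_sign_le[of v F x]
  by (auto intro!: integrable_bounded_support[where W = "cball 0 1" and c = 1] fmeasurable_cball
      simp: indicator_def)

lemma ray_hits_nonneg: "0 \<le> ray_hits v F x"
  unfolding ray_hits_def by (intro integral_nonneg_AE AE_I2) auto

lemma ray_hits_le: "ray_hits v F x \<le> 4/3 * pi"
proof -
  have "ray_hits v F x \<le> (LINT z|lborel. indicator (cball 0 1 :: (real^3) set) z)"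
    unfolding ray_hits_def using abs_ray_sign_le
    using fmeasurable_cball[of "0 :: real^3" 1]
    by (intro integral_mono integrable_ray_sign integrable_real_indicator)
      (auto simp: indicator_def fmeasurable_def)
  also have "\<dots> = 4/3 * pi" by (simp add: measure_cball_3)
  finally show ?thesis .
qed

lemma abs_ray_flux_le: "\<bar>ray_flux v F x\<bar> \<le> ray_hits v F x"
proof -
  have "\<bar>ray_flux v F x\<bar> \<le> (LINT z|lborel. \<bar>indicator (cball 0 1) z * ray_sign v F x z\<bar>)"
    unfolding ray_flux_def by (rule integral_abs_bound)
  then show ?thesis by (simp add: ray_hits_def abs_mult)
qed

lemma ray_flux_measurable: "ray_flux v F \<in> borel_measurable lborel"
  and ray_hits_integrand_measurable:
    "case_prod (\<lambda>x z. indicator (cball 0 1) z * \<bar>ray_sign v F x z\<bar>)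
      \<in> borel_measurable (lborel \<Otimes>\<^sub>M lborel)"
  and ray_hits_measurable: "ray_hits v F \<in> borel_measurable lborel"
proof -
  have ind: "(\<lambda>p. indicator (cball 0 1 :: (real^3) set) (snd p) :: real) \<in> borel_measurable (lborel \<Otimes>\<^sub>M lborel)"
    by (rule measurable_compose[OF measurable_snd]) (auto intro!: borel_measurable_indicator)
  have sgn: "(\<lambda>p. ray_sign v F (fst p) (snd p)) \<in> borel_measurable (lborel \<Otimes>\<^sub>M lborel)"
    using ray_sign_measurable[OF F plane] by (simp add: case_prod_beta')
  have "case_prod (\<lambda>x z. indicator (cball 0 1) z * ray_sign v F x z) \<in> borel_measurable (lborel \<Otimes>\<^sub>M lborel)"
    unfolding case_prod_beta' by (intro borel_measurable_times ind sgn)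
  then show "ray_flux v F \<in> borel_measurable lborel"
    unfolding ray_flux_def[abs_def] by (rule lborel.borel_measurable_lebesgue_integral)
  show prod: "case_prod (\<lambda>x z. indicator (cball 0 1) z * \<bar>ray_sign v F x z\<bar>) \<in> borel_measurable (lborel \<Otimes>\<^sub>M lborel)"
    unfolding case_prod_beta' by (intro borel_measurable_times borel_measurable_abs ind sgn)
  then show "ray_hits v F \<in> borel_measurable lborel"
    unfolding ray_hits_def[abs_def] by (rule lborel.borel_measurable_lebesgue_integral)
qed

lemma integrable_ray_flux:
  assumes "A \<in> fmeasurable lborel" shows "integrable lborel (\<lambda>x. indicator A x * ray_flux v F x)"
proof (rule integrable_bounded_support)
  show "(\<lambda>x. indicator A x * ray_flux v F x) \<in> borel_measurable lborel"
    using assms ray_flux_measurable by (intro borel_measurable_times borel_measurable_indicator) auto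
  show "\<bar>indicator A x * ray_flux v F x\<bar> \<le> 4/3 * pi * indicator A x" for x
    using abs_ray_flux_le[of x] ray_hits_le[of x] by (auto simp: indicator_def)
qed (rule assms)

lemma integrable_ray_hits:
  assumes "A \<in> fmeasurable lborel" shows "integrable lborel (\<lambda>x. indicator A x * ray_hits v F x)"
proof (rule integrable_bounded_support)
  show "(\<lambda>x. indicator A x * ray_hits v F x) \<in> borel_measurable lborel"
    using assms ray_hits_measurable by (intro borel_measurable_times borel_measurable_indicator) auto
  show "\<bar>indicator A x * ray_hits v F x\<bar> \<le> 4/3 * pi * indicator A x" for x
    using ray_hits_nonneg[of x] ray_hits_le[of x] by (auto simp: indicator_def)
qed (rule assms)

text \<open>
  After exchanging the integrals the direction \<open>z\<close> is fixed. The points \<open>x\<close> whose ray hits \<open>F\<close> then lie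
  within \<open>h\<close> of a segment of length \<open>2 R\<close> that runs backwards from \<open>y\<close>.
\<close>
lemma integral_ray_hits_le:
  assumes h: "0 < h" "h \<le> 2 * R" and F_ball: "F \<subseteq> cball y h" and F_R: "F \<subseteq> cball 0 R"
  shows "(LINT x|lborel. indicator (cball 0 R) x * ray_hits v F x) \<le> 4/3 * pi * (128 * pi * R * h\<^sup>2)"
proof -
  define f where "f x z = indicator (cball 0 R) x * (indicator (cball 0 1) z * \<bar>ray_sign v F x z\<bar>)"
    for x z :: "real^3"
  have R: "0 < R" using h by linarith
  have meas: "case_prod f \<in> borel_measurable (lborel \<Otimes>\<^sub>M lborel)"
  proof -
    have "(\<lambda>p. indicator (cball 0 R :: (real^3) set) (fst p) :: real) \<in> borel_measurable (lborel \<Otimes>\<^sub>M lborel)"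
      by (rule measurable_compose[OF measurable_fst]) (auto intro!: borel_measurable_indicator)
    from borel_measurable_times[OF this ray_hits_integrand_measurable]
    show ?thesis by (simp add: f_def case_prod_beta')
  qed
  have prod_fm: "cball 0 R \<times> cball 0 1 \<in> fmeasurable (lborel \<Otimes>\<^sub>M (lborel :: (real^3) measure))"
    for R :: real
    using fmeasurable_cball[of 0 R] fmeasurable_cball[of "0::real^3" 1]
    by (intro fmeasurableI) (auto simp: lborel.emeasure_pair_measure_Times fmeasurable_def ennreal_mult_less_top)
  have int: "integrable (lborel \<Otimes>\<^sub>M lborel) (case_prod f)"
    using meas prod_fm[of R]
    by (rule integrable_bounded_support[where c = 1]) (auto simp: f_def indicator_def abs_ray_sign_le split: if_splits)
  have slice: "(LINT x|lborel. f x z) \<le> indicator (cball 0 1) z * (128 * pi * R * h\<^sup>2)" for z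
  proof (cases "z \<in> cball 0 1 \<and> z \<noteq> 0")
    case False
    then have "f x z = 0" for x by (auto simp: f_def ray_sign_def)
    moreover have "0 \<le> indicator (cball 0 1) z * (128 * pi * R * h\<^sup>2)" using R by simp
    ultimately show ?thesis by simp
  next
    case True
    define w where "w = y - (2 * R / norm z) *\<^sub>R z"
    obtain W where W: "W \<in> fmeasurable lborel" "{p. \<exists>q\<in>closed_segment y w. dist q p \<le> h} \<subseteq> W"
      "measure lborel W \<le> 32 * pi * h\<^sup>2 * (dist y w + h)"
      by (rule thickened_segment_cover[OF h(1), of y w])
    have hit: "x \<in> W" if x: "x \<in> cball 0 R" and t: "0 < t" "x + t *\<^sub>R z \<in> F" for x t
    proof -
      have "t * norm z = norm ((x + t *\<^sub>R z) - x)" using t by simp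
      also have "\<dots> \<le> norm (x + t *\<^sub>R z) + norm x" by (rule norm_triangle_ineq4)
      also have "\<dots> \<le> 2 * R" using x subsetD[OF F_R t(2)] by simp
      finally have tz: "t * norm z \<le> 2 * R" .
      have "dist (y - t *\<^sub>R z) x = dist y (x + t *\<^sub>R z)" by (simp add: dist_norm algebra_simps)
      also have "\<dots> \<le> h" using t F_ball by auto
      finally have d: "dist (y - t *\<^sub>R z) x \<le> h" .
      define s where "s = t * norm z / (2 * R)"
      have s: "0 \<le> s" "s \<le> 1" using tz t R by (auto simp: s_def)
      have "s * (2 * R / norm z) = t" using True R by (simp add: s_def)
      moreover have "(1 - s) *\<^sub>R y + s *\<^sub>R w = y - (s * (2 * R / norm z)) *\<^sub>R z"
        by (simp add: w_def scaleR_diff_left scaleR_diff_right)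
      ultimately have "y - t *\<^sub>R z = (1 - s) *\<^sub>R y + s *\<^sub>R w" by simp
      then have "y - t *\<^sub>R z \<in> closed_segment y w" unfolding in_segment using s by blast
      then show "x \<in> W" using d by (intro subsetD[OF W(2)]) blast
    qed
    have "(LINT x|lborel. f x z) \<le> (LINT x|lborel. indicator W x)"
    proof (rule integral_mono_AE')
      show "integrable lborel (indicator W :: real^3 \<Rightarrow> real)"
        using W(1) by (intro integrable_real_indicator) (auto simp: fmeasurable_def)
      show "AE x in lborel. f x z \<le> indicator W x"
      proof (rule AE_I2)
        fix x :: "real^3"
        show "f x z \<le> indicator W x"
        proof (cases "x \<in> cball 0 R \<and> (\<exists>t>0. x + t *\<^sub>R z \<in> F)")
          case True
          then have "x \<in> W" using hit by blast
          then show ?thesis using abs_ray_sign_le[of v F x z] by (auto simp: f_def indicator_def)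
        next
          case False
          then have "f x z = 0" by (auto simp: f_def ray_sign_def)
          then show ?thesis by simp
        qed
      qed
      show "AE x in lborel. 0 \<le> (indicator W x :: real)" by (rule AE_I2) simp
    qed
    also have "\<dots> = measure lborel W" using W(1) by simp
    also have "\<dots> \<le> 32 * pi * h\<^sup>2 * (2 * R + h)"
      using W(3) True R by (simp add: w_def dist_norm)
    also have "\<dots> \<le> 32 * pi * h\<^sup>2 * (4 * R)" using h by (intro mult_left_mono) auto
    finally show ?thesis using True by (simp add: mult_ac)
  qed
  have "(LINT x|lborel. indicator (cball 0 R) x * ray_hits v F x) = (LINT x|lborel. LINT z|lborel. f x z)"
    by (simp add: f_def ray_hits_def)
  also have "\<dots> = (LINT z|lborel. LINT x|lborel. f x z)"
    by (rule lborel_pair.Fubini_integral[OF int, symmetric])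
  also have "\<dots> \<le> (LINT z|lborel. indicator (cball 0 1 :: (real^3) set) z * (128 * pi * R * h\<^sup>2))"
  proof (rule integral_mono)
    show "integrable lborel (\<lambda>z. LINT x|lborel. f x z)" by (rule lborel_pair.integrable_snd[OF int])
    show "integrable lborel (\<lambda>z. indicator (cball 0 1 :: (real^3) set) z * (128 * pi * R * h\<^sup>2))"
      using fmeasurable_cball[of "0::real^3" 1]
      by (intro integrable_mult_left integrable_real_indicator) (auto simp: fmeasurable_def)
  qed (rule slice)
  also have "\<dots> = 4/3 * pi * (128 * pi * R * h\<^sup>2)" by (simp add: measure_cball_3)
  finally show ?thesis .
qed

end

section \<open>Volume and decomposition of regular elements\<close>

lemma open_subset_cball_diameter:
  fixes T :: "'a::euclidean_space set"
  assumes "open T" "bounded T" "y \<in> T"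
  shows "0 < diameter T" "closure T \<subseteq> cball y (diameter T)"
proof -
  obtain e where e: "0 < e" "ball y e \<subseteq> T" using assms open_contains_ball by metis
  have "diameter (ball y e) \<le> diameter T" using e assms by (intro diameter_subset) auto
  then show "0 < diameter T" using e by (simp add: diameter_ball)
  show "closure T \<subseteq> cball y (diameter T)"
    using assms by (intro closure_minimal) (auto intro: diameter_bounded_bound)
qed

lemma cball_subset_of_inradius:
  fixes S :: "'a::euclidean_space set"
  assumes "bounded S" "S \<noteq> {}" "0 \<le> r" "r < inradius S"
  obtains x where "cball x r \<subseteq> S"
proof -
  define A where "A = {r. 0 \<le> r \<and> (\<exists>x. cball x r \<subseteq> S)}"
  have "A \<noteq> {}"
  proof -
    obtain x where "x \<in> S" using assms(2) by blast
    then have "0 \<in> A" by (auto simp: A_def intro!: exI[of _ x])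
    then show ?thesis by blast
  qed
  moreover have "bdd_above A"
  proof (rule bdd_aboveI)
    fix r assume "r \<in> A"
    then obtain x where x: "0 \<le> r" "cball x r \<subseteq> S" by (auto simp: A_def)
    then have "diameter (cball x r) \<le> diameter S" using assms(1) by (intro diameter_subset)
    then show "r \<le> diameter S" using x(1) by (simp add: diameter_cball)
  qed
  ultimately obtain r' where "r' \<in> A" "r < r'"
    using assms(4) less_cSup_iff[of A r] unfolding inradius_def A_def[symmetric] by metis
  then obtain x where "cball x r' \<subseteq> S" by (auto simp: A_def)
  then have "cball x r \<subseteq> S" using \<open>r < r'\<close> by (meson less_imp_le subset_cball subset_trans)
  then show thesis by (rule that)
qed

text \<open>
  The intersection is a face of both sets, and a face that meets the interior is the whole set.
\<close>
lemma triangulation_disjoint_interiors: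
  assumes "triangulation \<S>" "S \<in> \<S>" "S' \<in> \<S>" "S \<noteq> S'"
  shows "interior S \<inter> interior S' = {}"
proof -
  have f: "(S \<inter> S') face_of S" "(S' \<inter> S) face_of S'"
    using assms by (auto simp: triangulation_def)
  have "S \<inter> S' = S" "S' \<inter> S = S'" if "interior S \<inter> interior S' \<noteq> {}"
    using face_of_disjoint_interior[OF f(1)] face_of_disjoint_interior[OF f(2)] that
      interior_subset[of S] interior_subset[of S'] by blast+
  then show ?thesis using assms(4) by blast
qed

context oriented_polyhedral_mesh
begin

text \<open>
  The tetrahedra whose interior lies in \<open>T\<close> fill \<open>T\<close>. Each of them contains a ball of radius
  \<open>\<rho>\<^sup>2 h\<^sub>T / 2\<close>, half of the guaranteed inradius, and their interiors are disjoint subsets of a ball of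
  radius \<open>h\<^sub>T\<close>; comparing volumes bounds their number.
\<close>
lemma regular_element:
  assumes reg: "regularity_parameter \<rho> \<Omega> \<T> \<F> \<V>" and \<rho>: "0 < \<rho>" and T: "T \<in> \<T>"
  obtains \<S> where "finite \<S>" "\<forall>S\<in>\<S>. convex S" "closure T = \<Union>\<S>" "real (card \<S>) \<le> 8 / \<rho> ^ 6"
    and "4/3 * pi * (\<rho>\<^sup>2 / 2) ^ 3 * diameter T ^ 3 \<le> measure lborel T"
proof -
  obtain \<K> where sub: "matching_submesh \<Omega> \<T> \<F> \<K>"
    and inr: "\<forall>S\<in>\<K>. inradius S \<ge> \<rho> * diameter S"
    and size: "\<forall>S\<in>\<K>. \<forall>T\<in>\<T>. interior S \<subseteq> T \<longrightarrow> diameter S \<ge> \<rho> * diameter T"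
    using reg by (auto simp: regularity_parameter_def)
  have tri: "triangulation \<K>" and simplex: "\<And>S. S \<in> \<K> \<Longrightarrow> 3 simplex S"
    and cov: "\<Union>\<K> = closure \<Omega>" and inside: "\<And>S. S \<in> \<K> \<Longrightarrow> \<exists>T\<in>\<T>. interior S \<subseteq> T"
    using sub by (auto simp: matching_submesh_def)
  have conv: "convex S" and comp: "compact S" and ne: "S \<noteq> {}" if "S \<in> \<K>" for S
    using simplex_imp_polytope[OF simplex[OF that]] aff_dim_simplex[OF simplex[OF that]]
    by (auto intro: polytope_imp_convex polytope_imp_compact)
  note opT = open_polyhedron_3[OF polyhedron_element]
  have h_pos: "0 < diameter T" if "T \<in> \<T>" for T
    using open_subset_cball_diameter(1) opT[OF that] by blast
  have ball_in: "\<exists>x. cball x (\<rho>\<^sup>2 * diameter T / 2) \<subseteq> S" if "S \<in> \<K>" "T \<in> \<T>" "interior S \<subseteq> T" for S T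
  proof -
    have "\<rho> * (\<rho> * diameter T) \<le> \<rho> * diameter S" using size that \<rho> by (intro mult_left_mono) auto
    also have "\<dots> \<le> inradius S" using inr that by auto
    finally have "\<rho>\<^sup>2 * diameter T \<le> inradius S" by (simp add: power2_eq_square mult.assoc)
    moreover have "0 < \<rho>\<^sup>2 * diameter T" using \<rho> h_pos[OF that(2)] by simp
    ultimately have "\<rho>\<^sup>2 * diameter T / 2 < inradius S" "0 \<le> \<rho>\<^sup>2 * diameter T / 2" by linarith+
    then show ?thesis
      using cball_subset_of_inradius[OF compact_imp_bounded[OF comp] ne] that(1) by metis
  qed
  have cl_int: "closure (interior S) = S" if S: "S \<in> \<K>" for S
  proof -
    obtain T where T': "T \<in> \<T>" "interior S \<subseteq> T" using inside[OF S] by blast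
    obtain x where "cball x (\<rho>\<^sup>2 * diameter T / 2) \<subseteq> S" using ball_in[OF S T'] by blast
    then have "ball x (\<rho>\<^sup>2 * diameter T / 2) \<subseteq> interior S"
      by (intro interior_maximal) (use ball_subset_cball in blast)+
    moreover have "x \<in> ball x (\<rho>\<^sup>2 * diameter T / 2)" using \<rho> h_pos[OF T'(1)] by simp
    ultimately have "interior S \<noteq> {}" by blast
    then show ?thesis
      using convex_closure_interior[OF conv[OF S]] compact_imp_closed[OF comp[OF S]] by (simp add: closure_closed)
  qed
  define \<S> where "\<S> = {S\<in>\<K>. interior S \<subseteq> T}"
  have fin: "finite \<S>" using tri by (simp add: \<S>_def triangulation_def)
  have closure_eq: "closure T = \<Union>\<S>"
  proof
    show "\<Union>\<S> \<subseteq> closure T" using cl_int by (force simp: \<S>_def dest: closure_mono)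
    show "closure T \<subseteq> \<Union>\<S>"
    proof (rule closure_minimal)
      show "closed (\<Union>\<S>)" using fin comp by (intro closed_Union) (auto simp: \<S>_def compact_imp_closed)
      show "T \<subseteq> \<Union>\<S>"
      proof
        fix x assume x: "x \<in> T"
        have "x \<in> \<Union>\<K>" using x T elements_cover cov closure_subset by blast
        then obtain S where S: "S \<in> \<K>" "x \<in> S" by blast
        obtain T' where T': "T' \<in> \<T>" "interior S \<subseteq> T'" using inside[OF S(1)] by blast
        have "T' = T"
        proof (rule ccontr)
          assume "T' \<noteq> T"
          then have "T \<inter> interior S = {}" using T T' disjoint_elements by (auto simp: disjoint_def)
          then have "T \<inter> closure (interior S) = {}"
            using opT(1)[OF T] by (simp add: open_Int_closure_eq_empty)
          then show False using x S cl_int by auto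
        qed
        then show "x \<in> \<Union>\<S>" using S T' by (auto simp: \<S>_def)
      qed
    qed
  qed
  define r where "r = \<rho>\<^sup>2 / 2 * diameter T"
  have r: "0 < r" using \<rho> h_pos[OF T] by (simp add: r_def)
  have T_fm: "T \<in> fmeasurable lborel"
  proof (rule fmeasurableI2)
    show "T \<subseteq> cball (SOME y. y \<in> T) (diameter T)"
      using open_subset_cball_diameter(2)[OF opT(1,2)[OF T], of "SOME y. y \<in> T"] opT(3)[OF T]
        closure_subset some_in_eq by blast
  qed (use opT(1)[OF T] in \<open>auto intro: fmeasurable_cball\<close>)
  have int_fm: "interior S \<in> fmeasurable lborel" if "S \<in> \<S>" for S
    using that by (intro fmeasurableI2[OF T_fm]) (auto simp: \<S>_def)
  have vol: "4/3 * pi * r ^ 3 \<le> measure lborel (interior S)" if "S \<in> \<S>" for S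
  proof -
    have "r = \<rho>\<^sup>2 * diameter T / 2" by (simp add: r_def)
    moreover have "\<exists>x. cball x (\<rho>\<^sup>2 * diameter T / 2) \<subseteq> S"
      using ball_in[of S T] that T by (simp add: \<S>_def)
    ultimately obtain x where "cball x r \<subseteq> S" by auto
    then have "ball x r \<subseteq> interior S"
      by (intro interior_maximal) (use ball_subset_cball in blast)+
    then have "measure lborel (ball x r) \<le> measure lborel (interior S)"
      using int_fm[OF that] by (intro measure_mono_fmeasurable) auto
    then show ?thesis using r by (simp add: content_ball unit_ball_vol_3)
  qed
  show thesis
  proof
    show "finite \<S>" "closure T = \<Union>\<S>" by fact+
    show "\<forall>S\<in>\<S>. convex S" using conv by (auto simp: \<S>_def)
    obtain S where S: "S \<in> \<S>" using opT(3)[OF T] closure_eq closure_subset by blast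
    have "4/3 * pi * (\<rho>\<^sup>2 / 2) ^ 3 * diameter T ^ 3 = 4/3 * pi * r ^ 3"
      by (simp add: r_def power_mult_distrib power_divide)
    also have "\<dots> \<le> measure lborel (interior S)" by (rule vol[OF S])
    also have "\<dots> \<le> measure lborel T"
      using S T_fm by (intro measure_mono_fmeasurable) (auto simp: \<S>_def)
    finally show "4/3 * pi * (\<rho>\<^sup>2 / 2) ^ 3 * diameter T ^ 3 \<le> measure lborel T" .
    obtain y where y: "y \<in> T" using opT(3)[OF T] by blast
    have "real (card \<S>) * (4/3 * pi * r ^ 3) \<le> (\<Sum>S\<in>\<S>. measure lborel (interior S))"
      using vol by (intro sum_bounded_below)
    also have "\<dots> = measure lborel (\<Union>S\<in>\<S>. interior S)"
      using fin int_fm triangulation_disjoint_interiors[OF tri]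
      by (intro measure_UNION'[symmetric]) (auto simp: pairwise_def disjnt_def \<S>_def)
    also have "\<dots> \<le> measure lborel (cball y (diameter T))"
    proof (rule measure_mono_fmeasurable)
      show "(\<Union>S\<in>\<S>. interior S) \<subseteq> cball y (diameter T)"
        using open_subset_cball_diameter(2)[OF opT(1,2)[OF T] y] closure_subset[of T]
        by (auto simp: \<S>_def)
    next
      show "(\<Union>S\<in>\<S>. interior S) \<in> sets lborel" by (simp add: borel_open open_UN)
    qed (rule fmeasurable_cball)
    also have "\<dots> = 4/3 * pi * diameter T ^ 3"
      using h_pos[OF T] by (simp add: measure_cball_3)
    finally have "real (card \<S>) * r ^ 3 \<le> diameter T ^ 3" by simp
    moreover have "r ^ 3 = \<rho> ^ 6 / 8 * diameter T ^ 3"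
      by (simp add: r_def power_mult_distrib power_divide flip: power_mult)
    ultimately have "(real (card \<S>) * (\<rho> ^ 6 / 8)) * diameter T ^ 3 \<le> 1 * diameter T ^ 3"
      by (simp add: mult_ac)
    then have "real (card \<S>) * (\<rho> ^ 6 / 8) \<le> 1"
      using h_pos[OF T] by (simp only: mult_le_cancel_right) (metis not_less_iff_gr_or_eq zero_less_power)
    then show "real (card \<S>) \<le> 8 / \<rho> ^ 6" using \<rho> by (simp add: field_simps)
  qed
qed

end

section \<open>Solid angles of the faces of an element\<close>

context oriented_polyhedral_mesh
begin

lemma face_borel_in_plane:
  assumes "F \<in> \<F>"
  obtains c where "F \<in> sets borel" "F \<subseteq> {y. n F \<bullet> y = c}"
proof (cases "F = {}")
  case True
  show thesis by (rule that[of 0]) (use True in simp_all)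
next
  case False
  then obtain x where "x \<in> F" by blast
  have "F \<subseteq> {y. n F \<bullet> y = n F \<bullet> x}"
  proof
    fix y assume "y \<in> F"
    from normal_orthogonal[OF assms this \<open>x \<in> F\<close>] show "y \<in> {y. n F \<bullet> y = n F \<bullet> x}"
      by (simp add: inner_diff_right)
  qed
  with open_polyhedron_borel[OF polygon_face[OF assms]] show thesis by (rule that)
qed

text \<open>
  Gauss' law: the signed crossing count, integrated over the unit ball of directions.
\<close>
lemma sum_ray_flux:
  assumes T: "T \<in> \<T>" and x: "x \<notin> frontier T"
  shows "(\<Sum>F\<in>element_faces \<F> T. \<omega> T F * ray_flux (n F) F x) = 4/3 * pi * of_bool (x \<in> T)"
proof -
  have faces: "F \<in> \<F>" if "F \<in> element_faces \<F> T" for F using that by (simp add: element_faces_def)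
  have int: "integrable lborel (\<lambda>z. indicator (cball 0 1) z * ray_sign (n F) F x z)"
    if F: "F \<in> element_faces \<F> T" for F
  proof -
    obtain c where "F \<in> sets borel" "F \<subseteq> {y. n F \<bullet> y = c}"
      by (rule face_borel_in_plane[OF faces[OF F]])
    then show ?thesis by (rule integrable_ray_sign(1))
  qed
  have "(\<Sum>F\<in>element_faces \<F> T. \<omega> T F * ray_flux (n F) F x) =
      (LINT z|lborel. (\<Sum>F\<in>element_faces \<F> T. \<omega> T F * (indicator (cball 0 1) z * ray_sign (n F) F x z)))"
    unfolding ray_flux_def using int by (subst Bochner_Integration.integral_sum) auto
  also have "\<dots> = (LINT z|lborel. indicator (cball 0 1 :: (real^3) set) z * of_bool (x \<in> T))"
  proof (rule integral_cong_AE)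
    show "AE z in lborel. (\<Sum>F\<in>element_faces \<F> T. \<omega> T F * (indicator (cball 0 1) z * ray_sign (n F) F x z))
        = indicator (cball 0 1) z * of_bool (x \<in> T)"
      using AE_generic_direction[of x]
    proof (rule AE_mp, intro AE_I2 impI)
      fix z assume "generic_direction n \<F> x z"
      have "(\<Sum>F\<in>element_faces \<F> T. \<omega> T F * (indicator (cball 0 1) z * ray_sign (n F) F x z))
        = indicator (cball 0 1) z * (\<Sum>F\<in>element_faces \<F> T. \<omega> T F * ray_sign (n F) F x z)"
        by (simp add: sum_distrib_left mult_ac)
      with signed_crossings[OF \<open>generic_direction n \<F> x z\<close> T x]
      show "(\<Sum>F\<in>element_faces \<F> T. \<omega> T F * (indicator (cball 0 1) z * ray_sign (n F) F x z))
        = indicator (cball 0 1) z * of_bool (x \<in> T)"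
        by (simp only:)
    qed
    show "(\<lambda>z. \<Sum>F\<in>element_faces \<F> T. \<omega> T F * (indicator (cball 0 1) z * ray_sign (n F) F x z))
        \<in> borel_measurable lborel"
      using int by (intro borel_measurable_sum borel_measurable_times borel_measurable_integrable) auto
  qed (auto intro!: borel_measurable_indicator)
  also have "\<dots> = 4/3 * pi * of_bool (x \<in> T)" by (simp add: measure_cball_3)
  finally show ?thesis .
qed

text \<open>
  Almost every ray hits at most \<open>2 * card \<S>\<close> faces of \<open>T\<close>, and only rays that come within the diameter
  of \<open>T\<close> of the point \<open>y\<close> hit any.
\<close>
lemma sum_ray_hits_le:
  assumes T: "T \<in> \<T>" and y: "y \<in> T"
    and fin: "finite \<S>" and conv: "\<forall>S\<in>\<S>. convex S" and cover: "closure T = \<Union>\<S>"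
  shows "(\<Sum>F\<in>element_faces \<F> T. ray_hits (n F) F x)
    \<le> 2 * real (card \<S>) * (864 * pi * (diameter T / (dist x y + diameter T))\<^sup>2)"
proof -
  note opT = open_polyhedron_3[OF polyhedron_element[OF T]]
  note ball = open_subset_cball_diameter[OF opT(1,2) y]
  obtain W where W: "W \<in> fmeasurable lborel"
    "{z\<in>cball 0 1. \<exists>t\<ge>0. dist (x + t *\<^sub>R z) y \<le> diameter T} \<subseteq> W"
    "measure lborel W \<le> 864 * pi * (diameter T / (dist x y + diameter T))\<^sup>2"
    by (rule cone_of_directions_cover[OF ball(1), of x y])
  have faces: "F \<in> \<F>" if "F \<in> element_faces \<F> T" for F using that by (simp add: element_faces_def)
  have int: "integrable lborel (\<lambda>z. indicator (cball 0 1) z * \<bar>ray_sign (n F) F x z\<bar>)"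
    if F: "F \<in> element_faces \<F> T" for F
  proof -
    obtain c where "F \<in> sets borel" "F \<subseteq> {y. n F \<bullet> y = c}"
      by (rule face_borel_in_plane[OF faces[OF F]])
    then show ?thesis by (rule integrable_ray_sign(2))
  qed
  have "(\<Sum>F\<in>element_faces \<F> T. ray_hits (n F) F x) =
      (LINT z|lborel. (\<Sum>F\<in>element_faces \<F> T. indicator (cball 0 1) z * \<bar>ray_sign (n F) F x z\<bar>))"
    unfolding ray_hits_def using int by (subst Bochner_Integration.integral_sum) auto
  also have "\<dots> \<le> (LINT z|lborel. 2 * real (card \<S>) * indicator W z)"
  proof (rule integral_mono_AE)
    show "integrable lborel (\<lambda>z. \<Sum>F\<in>element_faces \<F> T. indicator (cball 0 1) z * \<bar>ray_sign (n F) F x z\<bar>)"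
      using int by (intro Bochner_Integration.integrable_sum)
    show "integrable lborel (\<lambda>z. 2 * real (card \<S>) * indicator W z)"
      using W(1) by (intro integrable_mult_right integrable_real_indicator) (auto simp: fmeasurable_def)
    show "AE z in lborel. (\<Sum>F\<in>element_faces \<F> T. indicator (cball 0 1) z * \<bar>ray_sign (n F) F x z\<bar>)
        \<le> 2 * real (card \<S>) * indicator W z"
      using AE_generic_direction[of x]
    proof (rule AE_mp, intro AE_I2 impI)
      fix z assume gen: "generic_direction n \<F> x z"
      define H where "H = {F\<in>element_faces \<F> T. \<exists>t>0. x + t *\<^sub>R z \<in> F}"
      have finF: "finite (element_faces \<F> T)" using finite_faces by (simp add: element_faces_def)
      show "(\<Sum>F\<in>element_faces \<F> T. indicator (cball 0 1) z * \<bar>ray_sign (n F) F x z\<bar>)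
        \<le> 2 * real (card \<S>) * indicator W z"
      proof (cases "z \<in> cball 0 1 \<and> H \<noteq> {}")
        case False
        then have "(\<Sum>F\<in>element_faces \<F> T. indicator (cball 0 1) z * \<bar>ray_sign (n F) F x z\<bar>) = 0"
          by (intro sum.neutral) (auto simp: H_def ray_sign_def)
        then show ?thesis by simp
      next
        case True
        then obtain F t where F: "F \<in> element_faces \<F> T" "t > 0" "x + t *\<^sub>R z \<in> F" by (auto simp: H_def)
        then have "x + t *\<^sub>R z \<in> closure T" by (auto simp: element_faces_def frontier_def)
        then have "dist (x + t *\<^sub>R z) y \<le> diameter T" using ball(2) by (auto simp: dist_commute)
        then have zW: "z \<in> W" using W(2) True F(2) less_imp_le by blast
        have "(\<Sum>F\<in>element_faces \<F> T. indicator (cball 0 1) z * \<bar>ray_sign (n F) F x z\<bar>) =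
            (\<Sum>F\<in>H. indicator (cball 0 1) z * \<bar>ray_sign (n F) F x z\<bar>)"
          using finF by (intro sum.mono_neutral_right) (auto simp: H_def ray_sign_def)
        also have "\<dots> \<le> (\<Sum>F\<in>H. 1)"
          by (intro sum_mono) (auto simp: indicator_def abs_ray_sign_le)
        also have "\<dots> = real (card H)" by simp
        also have "\<dots> \<le> 2 * real (card \<S>)"
        proof -
          have "card H \<le> 2 * card \<S>"
            unfolding H_def by (rule card_crossed_faces_le[OF gen T fin bspec[OF conv] cover])
          then show ?thesis by linarith
        qed
        finally show ?thesis using zW by simp
      qed
    qed
  qed
  also have "\<dots> = 2 * real (card \<S>) * measure lborel W" using W(1) by simp
  also have "\<dots> \<le> 2 * real (card \<S>) * (864 * pi * (diameter T / (dist x y + diameter T))\<^sup>2)"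
    by (intro mult_left_mono W(3)) auto
  finally show ?thesis .
qed

end

section \<open>Fluxes with prescribed balance and bounded energy\<close>

text \<open>
  The Cauchy-Schwarz inequality with weight \<open>K S F\<close> in the sum over \<open>S\<close>. One factor is bounded by
  \<open>row\<close>, and \<open>column\<close> bounds what remains after exchanging the sums.
\<close>
lemma weighted_Schur_bound:
  fixes k K :: "'t \<Rightarrow> 'f \<Rightarrow> real" and a h m :: "'t \<Rightarrow> real"
  assumes k: "\<And>S T F. S \<in> I \<Longrightarrow> T \<in> I \<Longrightarrow> F \<in> J T \<Longrightarrow> \<bar>k S F\<bar> \<le> K S F"
    and row: "\<And>T F. T \<in> I \<Longrightarrow> F \<in> J T \<Longrightarrow> (\<Sum>S\<in>I. K S F) \<le> C1 * (h T)\<^sup>2"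
    and column: "\<And>S. S \<in> I \<Longrightarrow> (\<Sum>T\<in>I. h T * (\<Sum>F\<in>J T. K S F)) \<le> C2 * m S"
    and h: "\<And>T. T \<in> I \<Longrightarrow> 0 < h T" and C1: "0 \<le> C1"
  shows "(\<Sum>T\<in>I. inverse (h T) * (\<Sum>F\<in>J T. (\<Sum>S\<in>I. a S * k S F)\<^sup>2)) \<le> C1 * C2 * (\<Sum>S\<in>I. (a S)\<^sup>2 * m S)"
proof -
  have K0: "0 \<le> K S F" if "S \<in> I" "T \<in> I" "F \<in> J T" for S T F
    using k[OF that] by linarith
  have square: "(\<Sum>S\<in>I. a S * k S F)\<^sup>2 \<le> C1 * (h T)\<^sup>2 * (\<Sum>S\<in>I. (a S)\<^sup>2 * K S F)"
    if T: "T \<in> I" "F \<in> J T" for T F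
  proof -
    have "\<bar>\<Sum>S\<in>I. a S * k S F\<bar> \<le> (\<Sum>S\<in>I. \<bar>a S\<bar> * K S F)"
      using k T by (intro order_trans[OF sum_abs] sum_mono) (auto simp: abs_mult intro: mult_left_mono)
    also have "\<dots> = (\<Sum>S\<in>I. (\<bar>a S\<bar> * sqrt (K S F)) * sqrt (K S F))"
      using K0[OF _ T] by (intro sum.cong) (auto simp: mult.assoc)
    finally have "\<bar>\<Sum>S\<in>I. a S * k S F\<bar>\<^sup>2 \<le> (\<Sum>S\<in>I. (\<bar>a S\<bar> * sqrt (K S F)) * sqrt (K S F))\<^sup>2"
      by (intro power_mono) auto
    also have "\<dots> \<le> (\<Sum>S\<in>I. (\<bar>a S\<bar> * sqrt (K S F))\<^sup>2) * (\<Sum>S\<in>I. (sqrt (K S F))\<^sup>2)"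
      by (rule Cauchy_Schwarz_ineq_sum)
    also have "\<dots> = (\<Sum>S\<in>I. (a S)\<^sup>2 * K S F) * (\<Sum>S\<in>I. K S F)"
      using K0[OF _ T] by (simp add: power_mult_distrib)
    also have "\<dots> \<le> (\<Sum>S\<in>I. (a S)\<^sup>2 * K S F) * (C1 * (h T)\<^sup>2)"
      using K0[OF _ T] by (intro mult_left_mono row T sum_nonneg) auto
    finally show ?thesis by (simp add: mult_ac)
  qed
  have "(\<Sum>T\<in>I. inverse (h T) * (\<Sum>F\<in>J T. (\<Sum>S\<in>I. a S * k S F)\<^sup>2))
      \<le> (\<Sum>T\<in>I. inverse (h T) * (\<Sum>F\<in>J T. C1 * (h T)\<^sup>2 * (\<Sum>S\<in>I. (a S)\<^sup>2 * K S F)))"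
    using h by (intro sum_mono mult_left_mono square) (auto simp: less_imp_le)
  also have "\<dots> = (\<Sum>T\<in>I. \<Sum>F\<in>J T. \<Sum>S\<in>I. C1 * ((a S)\<^sup>2 * (h T * K S F)))"
  proof (intro sum.cong refl)
    fix T assume T: "T \<in> I"
    have "inverse (h T) * (h T)\<^sup>2 = h T" using h[OF T] by (simp add: power2_eq_square)
    then have eq: "inverse (h T) * (C1 * (h T)\<^sup>2 * X) = C1 * (h T * X)" for X
      by (metis mult.assoc mult.left_commute)
    show "inverse (h T) * (\<Sum>F\<in>J T. C1 * (h T)\<^sup>2 * (\<Sum>S\<in>I. (a S)\<^sup>2 * K S F)) =
        (\<Sum>F\<in>J T. \<Sum>S\<in>I. C1 * ((a S)\<^sup>2 * (h T * K S F)))"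
      unfolding sum_distrib_left[of "inverse (h T)"] eq
      by (intro sum.cong refl) (simp add: sum_distrib_left mult_ac)
  qed
  also have "\<dots> = (\<Sum>S\<in>I. \<Sum>T\<in>I. \<Sum>F\<in>J T. C1 * ((a S)\<^sup>2 * (h T * K S F)))"
    by (subst sum.swap[of _ I I], intro sum.cong refl sum.swap)
  also have "\<dots> = (\<Sum>S\<in>I. C1 * (a S)\<^sup>2 * (\<Sum>T\<in>I. h T * (\<Sum>F\<in>J T. K S F)))"
    by (simp add: sum_distrib_left mult_ac)
  also have "\<dots> \<le> (\<Sum>S\<in>I. C1 * (a S)\<^sup>2 * (C2 * m S))"
    using C1 by (intro sum_mono mult_left_mono column) auto
  also have "\<dots> = C1 * C2 * (\<Sum>S\<in>I. (a S)\<^sup>2 * m S)"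
    by (simp add: sum_distrib_left mult_ac)
  finally show ?thesis .
qed

context oriented_polyhedral_mesh
begin

lemma element_in_ball:
  assumes T: "T \<in> \<T>" and R: "closure \<Omega> \<subseteq> cball 0 R"
  shows "closure T \<subseteq> cball 0 R" "diameter T \<le> 2 * R"
proof -
  show sub: "closure T \<subseteq> cball 0 R" using T elements_cover R by blast
  then have "T \<subseteq> cball 0 R" using closure_subset by blast
  then have le: "diameter T \<le> diameter (cball (0::real^3) R)" by (intro diameter_subset) auto
  have "T \<noteq> {}" using open_polyhedron_3(3)[OF polyhedron_element[OF T]] .
  then have "0 \<le> R" using \<open>T \<subseteq> cball 0 R\<close> by force
  then show "diameter T \<le> 2 * R" using le by (simp add: diameter_cball)
qed

text \<open>
  The cone estimate gives each element a share of order \<open>h\<^sub>T\<^sup>3 / D\<^sub>T\<^sup>2\<close>; by the volume bound this is at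
  most a multiple of \<open>|T| / D\<^sub>T\<^sup>2\<close>, and the elements are a packing.
\<close>
lemma weighted_ray_hits_le:
  assumes reg: "regularity_parameter \<rho> \<Omega> \<T> \<F> \<V>" and \<rho>: "0 < \<rho>"
    and R: "closure \<Omega> \<subseteq> cball 0 R" "0 < R" and x: "x \<in> cball 0 R"
  shows "(\<Sum>T\<in>\<T>. diameter T * (\<Sum>F\<in>element_faces \<F> T. ray_hits (n F) F x))
    \<le> (16 / \<rho> ^ 6 * (864 * pi)) / (4/3 * pi * (\<rho>\<^sup>2 / 2) ^ 3) * (32 * pi * R)"
proof -
  define N where "N = 16 / \<rho> ^ 6 * (864 * pi)"
  define c where "c = 4/3 * pi * (\<rho>\<^sup>2 / 2) ^ 3"
  have N: "0 < N" and c: "0 < c" using \<rho> by (auto simp: N_def c_def)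
  have "\<forall>T\<in>\<T>. \<exists>y. y \<in> T" using open_polyhedron_3(3)[OF polyhedron_element] by blast
  then obtain y where y: "\<And>T. T \<in> \<T> \<Longrightarrow> y T \<in> T" by metis
  define D where "D T = dist x (y T) + diameter T" for T
  note opT = open_polyhedron_3[OF polyhedron_element]
  have h: "0 < diameter T" and sub: "closure T \<subseteq> cball (y T) (diameter T)" if "T \<in> \<T>" for T
    using open_subset_cball_diameter[OF opT(1,2)[OF that] y[OF that]] by auto
  have D0: "0 < D T" if "T \<in> \<T>" for T using h[OF that] by (simp add: D_def add_nonneg_pos)
  have "diameter T * (\<Sum>F\<in>element_faces \<F> T. ray_hits (n F) F x) \<le> N / c * (measure lborel T / (D T)\<^sup>2)"
    if T: "T \<in> \<T>" for T
  proof -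
    obtain \<S> where \<S>: "finite \<S>" "\<forall>S\<in>\<S>. convex S" "closure T = \<Union>\<S>" "real (card \<S>) \<le> 8 / \<rho> ^ 6"
      and vol: "4/3 * pi * (\<rho>\<^sup>2 / 2) ^ 3 * diameter T ^ 3 \<le> measure lborel T"
      by (rule regular_element[OF reg \<rho> T])
    have "(\<Sum>F\<in>element_faces \<F> T. ray_hits (n F) F x)
        \<le> 2 * real (card \<S>) * (864 * pi * (diameter T / D T)\<^sup>2)"
      unfolding D_def by (rule sum_ray_hits_le[OF T y[OF T] \<S>(1-3)])
    also have "\<dots> \<le> 2 * (8 / \<rho> ^ 6) * (864 * pi * (diameter T / D T)\<^sup>2)"
      by (intro mult_right_mono mult_left_mono \<S>(4)) auto
    also have "\<dots> = N * (diameter T / D T)\<^sup>2" by (simp add: N_def)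
    finally have "diameter T * (\<Sum>F\<in>element_faces \<F> T. ray_hits (n F) F x)
        \<le> diameter T * (N * (diameter T / D T)\<^sup>2)"
      using h[OF T] by (intro mult_left_mono) auto
    also have "\<dots> = N / (D T)\<^sup>2 * diameter T ^ 3"
      by (simp add: power_divide power2_eq_square power3_eq_cube)
    also have "\<dots> \<le> N / (D T)\<^sup>2 * (measure lborel T / c)"
    proof (rule mult_left_mono)
      show "diameter T ^ 3 \<le> measure lborel T / c"
        using vol c unfolding c_def[symmetric] by (simp add: field_simps)
    qed (use N in auto)
    finally show ?thesis by (simp add: mult_ac)
  qed
  then have "(\<Sum>T\<in>\<T>. diameter T * (\<Sum>F\<in>element_faces \<F> T. ray_hits (n F) F x))
      \<le> (\<Sum>T\<in>\<T>. N / c * (measure lborel T / (D T)\<^sup>2))"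
    by (rule sum_mono)
  also have "\<dots> = N / c * (\<Sum>T\<in>\<T>. measure lborel T / (D T)\<^sup>2)" by (rule sum_distrib_left[symmetric])
  also have "\<dots> \<le> N / c * (8 * pi * (4 * R))"
  proof (rule mult_left_mono)
    show "(\<Sum>T\<in>\<T>. measure lborel T / (D T)\<^sup>2) \<le> 8 * pi * (4 * R)"
    proof (rule packing_inverse_square_sum[where x = x])
      show "disjoint_family_on (\<lambda>T. T) \<T>"
        using disjoint_elements by (auto simp: disjoint_family_on_def disjoint_def)
      fix T assume T: "T \<in> \<T>"
      show "T \<in> sets lborel" using opT(1)[OF T] by simp
      show "0 < D T" by (rule D0[OF T])
      have "y T \<in> cball 0 R" using element_in_ball(1)[OF T R(1)] y[OF T] closure_subset by blast
      then have "dist x (y T) \<le> R + R"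
        using x by (intro order_trans[OF dist_triangle[of x "y T" 0]] add_mono) (auto simp: dist_commute)
      then show "D T \<le> 4 * R" using element_in_ball(2)[OF T R(1)] by (simp add: D_def)
      show "T \<subseteq> cball x (D T)"
      proof
        fix w assume "w \<in> T"
        then have "dist (y T) w \<le> diameter T" using sub[OF T] closure_subset by fastforce
        then show "w \<in> cball x (D T)" using dist_triangle[of x w "y T"] by (simp add: D_def)
      qed
    qed (use R finite_elements in auto)
  qed (use N c in auto)
  finally show ?thesis by (simp add: N_def c_def mult_ac)
qed

text \<open>
  Here \<open>k S F\<close> is what a unit source density in \<open>S\<close> sends through \<open>F\<close>, and \<open>b\<close>, the volume of the unit
  ball of directions, is the total that a point sends out by Gauss' law. So the density in \<open>S\<close> has to
  be \<open>\<alpha> S / (b |S|)\<close>.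
\<close>
lemma fluxes_with_energy_bound:
  fixes \<alpha> :: "(real^3) set \<Rightarrow> real"
  assumes reg: "regularity_parameter \<rho> \<Omega> \<T> \<F> \<V>" and \<rho>: "0 < \<rho>"
    and R: "closure \<Omega> \<subseteq> cball 0 R" "0 < R"
  defines "b \<equiv> 4/3 * pi" and "c \<equiv> 4/3 * pi * (\<rho>\<^sup>2 / 2) ^ 3"
  defines "C1 \<equiv> b * (128 * pi * R)" and "C2 \<equiv> (16 / \<rho> ^ 6 * (864 * pi)) / c * (32 * pi * R)"
  obtains \<beta> :: "(real^3) set \<Rightarrow> real"
  where "\<forall>T\<in>\<T>. (\<Sum>F\<in>element_faces \<F> T. \<omega> T F * \<beta> F) = \<alpha> T"
    and "(\<Sum>T\<in>\<T>. inverse (diameter T) * (\<Sum>F\<in>element_faces \<F> T. (\<beta> F)\<^sup>2))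
      \<le> C1 * C2 / (b\<^sup>2 * c) * (\<Sum>T\<in>\<T>. inverse (diameter T ^ 3) * (\<alpha> T)\<^sup>2)"
proof -
  define m :: "(real^3) set \<Rightarrow> real" where "m T = measure lborel T" for T
  define k where "k S F = (LINT x|lborel. indicator S x * ray_flux (n F) F x)" for S F
  define K where "K S F = (LINT x|lborel. indicator S x * ray_hits (n F) F x)" for S F
  define a where "a S = \<alpha> S / (b * m S)" for S
  define \<beta> where "\<beta> F = (\<Sum>S\<in>\<T>. a S * k S F)" for F
  note opT = open_polyhedron_3[OF polyhedron_element]
  have b: "0 < b" and c: "0 < c" using \<rho> by (auto simp: b_def c_def)
  have C1: "0 < C1" and C2: "0 < C2" using b c R(2) \<rho> by (auto simp: C1_def C2_def)
  have h: "0 < diameter T" if "T \<in> \<T>" for T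
    using open_subset_cball_diameter(1)[OF opT(1,2)[OF that]] opT(3)[OF that] by blast
  have vol: "c * diameter T ^ 3 \<le> m T" if "T \<in> \<T>" for T
    unfolding c_def m_def by (rule regular_element[OF reg \<rho> that])
  have m: "0 < m T" if "T \<in> \<T>" for T
    using vol[OF that] c h[OF that] by (meson mult_pos_pos less_le_trans zero_less_power)
  have in_R: "T \<subseteq> cball 0 R" if "T \<in> \<T>" for T
    using element_in_ball(1)[OF that R(1)] closure_subset by blast
  have fm: "T \<in> fmeasurable lborel" if "T \<in> \<T>" for T
    using in_R[OF that] opT(1)[OF that] by (intro fmeasurableI2[OF fmeasurable_cball]) auto
  have faces: "F \<in> \<F>" if "F \<in> element_faces \<F> T" for F T using that by (simp add: element_faces_def)
  have int_flux: "integrable lborel (\<lambda>x. indicator A x * ray_flux (n F) F x)"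
    and int_hits: "integrable lborel (\<lambda>x. indicator A x * ray_hits (n F) F x)"
    and hits_nonneg: "0 \<le> ray_hits (n F) F x"
    and flux_le: "\<bar>ray_flux (n F) F x\<bar> \<le> ray_hits (n F) F x"
    if F: "F \<in> \<F>" and A: "A \<in> fmeasurable lborel" for F A x
  proof -
    obtain d where d: "F \<in> sets borel" "F \<subseteq> {y. n F \<bullet> y = d}"
      by (rule face_borel_in_plane[OF F])
    show "integrable lborel (\<lambda>x. indicator A x * ray_flux (n F) F x)"
      by (rule integrable_ray_flux[OF d A])
    show "integrable lborel (\<lambda>x. indicator A x * ray_hits (n F) F x)"
      by (rule integrable_ray_hits[OF d A])
    show "0 \<le> ray_hits (n F) F x" by (rule ray_hits_nonneg[OF d])
    show "\<bar>ray_flux (n F) F x\<bar> \<le> ray_hits (n F) F x" by (rule abs_ray_flux_le[OF d])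
  qed
  have k_div: "(\<Sum>F\<in>element_faces \<F> T. \<omega> T F * k S F) = b * m T * of_bool (S = T)"
    if S: "S \<in> \<T>" and T: "T \<in> \<T>" for S T
  proof -
    have out: "x \<notin> frontier T" "x \<in> T \<longleftrightarrow> S = T" if "x \<in> S" for x
    proof -
      have "S \<inter> closure T = {}" if "S \<noteq> T"
        using opT(1)[OF S] disjoint_elements S T that
        by (simp add: open_Int_closure_eq_empty disjoint_def)
      then show "x \<notin> frontier T" "x \<in> T \<longleftrightarrow> S = T"
        using \<open>x \<in> S\<close> opT(1)[OF T] closure_subset[of T] by (auto simp: frontier_def interior_open)
    qed
    have "(\<Sum>F\<in>element_faces \<F> T. \<omega> T F * k S F) =
        (LINT x|lborel. (\<Sum>F\<in>element_faces \<F> T. \<omega> T F * (indicator S x * ray_flux (n F) F x)))"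
      unfolding k_def using int_flux[OF faces fm[OF S]]
      by (subst Bochner_Integration.integral_sum) auto
    also have "\<dots> = (LINT x|lborel. indicator S x * (b * of_bool (S = T)))"
    proof (rule Bochner_Integration.integral_cong[OF refl])
      fix x
      have "(\<Sum>F\<in>element_faces \<F> T. \<omega> T F * (indicator S x * ray_flux (n F) F x)) =
          indicator S x * (\<Sum>F\<in>element_faces \<F> T. \<omega> T F * ray_flux (n F) F x)"
        by (simp add: sum_distrib_left mult_ac)
      also have "\<dots> = indicator S x * (b * of_bool (S = T))"
      proof (cases "x \<in> S")
        case True
        then show ?thesis using sum_ray_flux[OF T out(1)[OF True]] out(2)[OF True] by (simp add: b_def)
      qed simp
      finally show "(\<Sum>F\<in>element_faces \<F> T. \<omega> T F * (indicator S x * ray_flux (n F) F x)) =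
          indicator S x * (b * of_bool (S = T))" .
    qed
    also have "\<dots> = b * m T * of_bool (S = T)"
      using fm[OF S] by (auto simp: m_def fmeasurable_def)
    finally show ?thesis .
  qed
  have conservation: "(\<Sum>F\<in>element_faces \<F> T. \<omega> T F * \<beta> F) = \<alpha> T" if T: "T \<in> \<T>" for T
  proof -
    have "(\<Sum>F\<in>element_faces \<F> T. \<omega> T F * \<beta> F) =
        (\<Sum>F\<in>element_faces \<F> T. \<Sum>S\<in>\<T>. a S * (\<omega> T F * k S F))"
      unfolding \<beta>_def by (simp add: sum_distrib_left mult_ac)
    also have "\<dots> = (\<Sum>S\<in>\<T>. a S * (\<Sum>F\<in>element_faces \<F> T. \<omega> T F * k S F))"
      by (subst sum.swap) (simp add: sum_distrib_left)
    also have "\<dots> = (\<Sum>S\<in>\<T>. if S = T then a T * (b * m T) else 0)"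
      using T by (intro sum.cong refl) (auto simp: k_div)
    also have "\<dots> = a T * (b * m T)" using T finite_elements by simp
    also have "\<dots> = \<alpha> T" using m[OF T] b by (simp add: a_def)
    finally show ?thesis .
  qed
  have row: "(\<Sum>S\<in>\<T>. K S F) \<le> C1 * (diameter T)\<^sup>2"
    if T: "T \<in> \<T>" and F: "F \<in> element_faces \<F> T" for T F
  proof -
    obtain y where y: "y \<in> T" using opT(3)[OF T] by blast
    have F_cl: "F \<subseteq> closure T" using F by (auto simp: element_faces_def frontier_def)
    obtain d where d: "F \<in> sets borel" "F \<subseteq> {y. n F \<bullet> y = d}"
      by (rule face_borel_in_plane[OF faces[OF F]])
    have "(\<Sum>S\<in>\<T>. K S F) = (LINT x|lborel. (\<Sum>S\<in>\<T>. indicator S x * ray_hits (n F) F x))"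
      unfolding K_def using int_hits[OF faces[OF F] fm]
      by (subst Bochner_Integration.integral_sum) auto
    also have "\<dots> \<le> (LINT x|lborel. indicator (cball 0 R) x * ray_hits (n F) F x)"
    proof (rule integral_mono)
      show "integrable lborel (\<lambda>x. \<Sum>S\<in>\<T>. indicator S x * ray_hits (n F) F x)"
        using int_hits[OF faces[OF F] fm] by (intro Bochner_Integration.integrable_sum)
      show "integrable lborel (\<lambda>x. indicator (cball 0 R) x * ray_hits (n F) F x)"
        by (rule int_hits[OF faces[OF F] fmeasurable_cball])
      fix x
      have "(\<Sum>S\<in>\<T>. indicator S x) = (indicator (\<Union>\<T>) x :: real)"
        using disjoint_elements finite_elements
        by (subst indicator_UN_disjoint[of \<T> "\<lambda>T. T", simplified, symmetric])
          (auto simp: disjoint_family_on_def disjoint_def)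
      also have "\<dots> \<le> indicator (cball 0 R) x"
      proof -
        have "\<Union>\<T> \<subseteq> cball 0 R" using in_R by blast
        then show ?thesis unfolding indicator_def by auto
      qed
      finally show "(\<Sum>S\<in>\<T>. indicator S x * ray_hits (n F) F x) \<le> indicator (cball 0 R) x * ray_hits (n F) F x"
        unfolding sum_distrib_right[symmetric]
        by (intro mult_right_mono hits_nonneg[OF faces[OF F] fmeasurable_cball])
    qed
    also have "\<dots> \<le> 4/3 * pi * (128 * pi * R * (diameter T)\<^sup>2)"
    proof (rule integral_ray_hits_le[OF d h[OF T] element_in_ball(2)[OF T R(1)]])
      show "F \<subseteq> cball y (diameter T)"
        using F_cl open_subset_cball_diameter(2)[OF opT(1,2)[OF T] y] by blast
      show "F \<subseteq> cball 0 R" using F_cl element_in_ball(1)[OF T R(1)] by blast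
    qed
    finally show ?thesis by (simp add: C1_def b_def mult_ac)
  qed
  have column: "(\<Sum>T\<in>\<T>. diameter T * (\<Sum>F\<in>element_faces \<F> T. K S F)) \<le> C2 * m S" if S: "S \<in> \<T>" for S
  proof -
    have "(\<Sum>T\<in>\<T>. diameter T * (\<Sum>F\<in>element_faces \<F> T. K S F)) =
        (LINT x|lborel. (\<Sum>T\<in>\<T>. diameter T * (\<Sum>F\<in>element_faces \<F> T. indicator S x * ray_hits (n F) F x)))"
      unfolding K_def using int_hits[OF faces fm[OF S]]
      by (simp add: Bochner_Integration.integral_sum Bochner_Integration.integrable_sum)
    also have "\<dots> \<le> (LINT x|lborel. indicator S x * C2)"
    proof (rule integral_mono)
      show "integrable lborel
          (\<lambda>x. \<Sum>T\<in>\<T>. diameter T * (\<Sum>F\<in>element_faces \<F> T. indicator S x * ray_hits (n F) F x))"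
        using int_hits[OF faces fm[OF S]]
        by (intro Bochner_Integration.integrable_sum integrable_mult_right)
      show "integrable lborel (\<lambda>x. indicator S x * C2)"
        using fm[OF S] by (intro integrable_mult_left integrable_real_indicator) (auto simp: fmeasurable_def)
      fix x
      have eq: "(\<Sum>T\<in>\<T>. diameter T * (\<Sum>F\<in>element_faces \<F> T. indicator S x * ray_hits (n F) F x)) =
          indicator S x * (\<Sum>T\<in>\<T>. diameter T * (\<Sum>F\<in>element_faces \<F> T. ray_hits (n F) F x))"
        by (simp add: sum_distrib_left mult_ac)
      show "(\<Sum>T\<in>\<T>. diameter T * (\<Sum>F\<in>element_faces \<F> T. indicator S x * ray_hits (n F) F x)) \<le> indicator S x * C2"
      proof (cases "x \<in> S")
        case True
        then have "x \<in> cball 0 R" using in_R[OF S] by blast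
        from weighted_ray_hits_le[OF reg \<rho> R this] True show ?thesis
          unfolding eq C2_def c_def by simp
      qed (simp add: eq)
    qed
    also have "\<dots> = C2 * m S" using fm[OF S] by (simp add: m_def fmeasurable_def)
    finally show ?thesis .
  qed
  show thesis
  proof
    show "\<forall>T\<in>\<T>. (\<Sum>F\<in>element_faces \<F> T. \<omega> T F * \<beta> F) = \<alpha> T" using conservation by blast
    have "(\<Sum>T\<in>\<T>. inverse (diameter T) * (\<Sum>F\<in>element_faces \<F> T. (\<beta> F)\<^sup>2))
        \<le> C1 * C2 * (\<Sum>S\<in>\<T>. (a S)\<^sup>2 * m S)"
      unfolding \<beta>_def
    proof (rule weighted_Schur_bound[where K = K])
      fix S T F assume S: "S \<in> \<T>" and F: "F \<in> element_faces \<F> T"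
      have "\<bar>k S F\<bar> \<le> (LINT x|lborel. \<bar>indicator S x * ray_flux (n F) F x\<bar>)"
        unfolding k_def by (rule integral_abs_bound)
      also have "\<dots> \<le> K S F"
        unfolding K_def
      proof (rule integral_mono)
        show "integrable lborel (\<lambda>x. \<bar>indicator S x * ray_flux (n F) F x\<bar>)"
          by (intro integrable_abs int_flux[OF faces[OF F] fm[OF S]])
        show "integrable lborel (\<lambda>x. indicator S x * ray_hits (n F) F x)"
          by (rule int_hits[OF faces[OF F] fm[OF S]])
        show "\<bar>indicator S x * ray_flux (n F) F x\<bar> \<le> indicator S x * ray_hits (n F) F x" for x
          using flux_le[OF faces[OF F] fm[OF S], of x] by (simp add: abs_mult mult_left_mono)
      qed
      finally show "\<bar>k S F\<bar> \<le> K S F" .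
    qed (use row column h C1 in auto)
    also have "\<dots> \<le> C1 * C2 * (\<Sum>S\<in>\<T>. 1 / (b\<^sup>2 * c) * (inverse (diameter S ^ 3) * (\<alpha> S)\<^sup>2))"
    proof (intro mult_left_mono sum_mono)
      fix S assume S: "S \<in> \<T>"
      have "(a S)\<^sup>2 * m S = (\<alpha> S)\<^sup>2 / b\<^sup>2 * (1 / m S)"
        using m[OF S] by (simp add: a_def power_divide power_mult_distrib power2_eq_square)
      also have "\<dots> \<le> (\<alpha> S)\<^sup>2 / b\<^sup>2 * (1 / (c * diameter S ^ 3))"
        using vol[OF S] c h[OF S] by (intro mult_left_mono frac_le) auto
      also have "\<dots> = 1 / (b\<^sup>2 * c) * (inverse (diameter S ^ 3) * (\<alpha> S)\<^sup>2)"
        by (simp add: divide_inverse mult_ac)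
      finally show "(a S)\<^sup>2 * m S \<le> 1 / (b\<^sup>2 * c) * (inverse (diameter S ^ 3) * (\<alpha> S)\<^sup>2)" .
    qed (use C1 C2 in auto)
    also have "\<dots> = C1 * C2 / (b\<^sup>2 * c) * (\<Sum>T\<in>\<T>. inverse (diameter T ^ 3) * (\<alpha> T)\<^sup>2)"
      by (simp only: sum_distrib_left[symmetric]) simp
    finally show "(\<Sum>T\<in>\<T>. inverse (diameter T) * (\<Sum>F\<in>element_faces \<F> T. (\<beta> F)\<^sup>2))
      \<le> C1 * C2 / (b\<^sup>2 * c) * (\<Sum>T\<in>\<T>. inverse (diameter T ^ 3) * (\<alpha> T)\<^sup>2)" .
  qed
qed

end

theorem theorem7:
  fixes \<Omega> :: "(real^3) set" and \<rho> :: real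
  assumes "polyhedral_domain \<Omega>" and "\<rho> > 0"
  shows "\<exists>C>0. \<forall>\<T> \<F> \<E> \<V> n \<omega>.
    oriented_polyhedral_mesh \<Omega> \<T> \<F> \<E> \<V> n \<omega> \<and> regularity_parameter \<rho> \<Omega> \<T> \<F> \<V> \<longrightarrow>
    (\<forall>\<alpha> :: (real^3) set \<Rightarrow> real. \<exists>\<beta> :: (real^3) set \<Rightarrow> real.
       (\<forall>T\<in>\<T>. (\<Sum>F\<in>element_faces \<F> T. \<omega> T F * \<beta> F) = \<alpha> T) \<and>
       (\<Sum>T\<in>\<T>. inverse (diameter T) * (\<Sum>F\<in>element_faces \<F> T. (\<beta> F)\<^sup>2))
         \<le> C * (\<Sum>T\<in>\<T>. inverse (diameter T ^ 3) * (\<alpha> T)\<^sup>2))"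
proof -
  have "bounded \<Omega>" using open_polyhedron_3(2) assms(1) by (simp add: polyhedral_domain_def)
  then have "bounded (closure \<Omega>)" by (rule bounded_closure)
  then obtain R where R: "0 < R" "closure \<Omega> \<subseteq> cball 0 R"
    unfolding bounded_pos by (metis mem_cball_0 subsetI)
  define b c :: real where "b = 4/3 * pi" and "c = 4/3 * pi * (\<rho>\<^sup>2 / 2) ^ 3"
  define C1 C2 where "C1 = b * (128 * pi * R)"
    and "C2 = (16 / \<rho> ^ 6 * (864 * pi)) / c * (32 * pi * R)"
  note defs = b_def c_def C1_def C2_def
  show ?thesis
  proof (intro exI[of _ "C1 * C2 / (b\<^sup>2 * c)"] conjI allI impI)
    show "0 < C1 * C2 / (b\<^sup>2 * c)" using assms(2) R(1) by (simp add: defs)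
    fix \<T> \<F> \<E> :: "(real^3) set set" and \<V> :: "(real^3) set"
      and n :: "(real^3) set \<Rightarrow> real^3" and \<omega> :: "(real^3) set \<Rightarrow> (real^3) set \<Rightarrow> real"
      and \<alpha> :: "(real^3) set \<Rightarrow> real"
    assume mesh: "oriented_polyhedral_mesh \<Omega> \<T> \<F> \<E> \<V> n \<omega> \<and> regularity_parameter \<rho> \<Omega> \<T> \<F> \<V>"
    then interpret oriented_polyhedral_mesh \<Omega> \<T> \<F> \<E> \<V> n \<omega> by simp
    obtain \<beta> where "\<forall>T\<in>\<T>. (\<Sum>F\<in>element_faces \<F> T. \<omega> T F * \<beta> F) = \<alpha> T"
      "(\<Sum>T\<in>\<T>. inverse (diameter T) * (\<Sum>F\<in>element_faces \<F> T. (\<beta> F)\<^sup>2))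
        \<le> C1 * C2 / (b\<^sup>2 * c) * (\<Sum>T\<in>\<T>. inverse (diameter T ^ 3) * (\<alpha> T)\<^sup>2)"
      using fluxes_with_energy_bound[OF conjunct2[OF mesh] assms(2) R(2,1), of \<alpha>]
      unfolding defs by blast
    then show "\<exists>\<beta>. (\<forall>T\<in>\<T>. (\<Sum>F\<in>element_faces \<F> T. \<omega> T F * \<beta> F) = \<alpha> T) \<and>
       (\<Sum>T\<in>\<T>. inverse (diameter T) * (\<Sum>F\<in>element_faces \<F> T. (\<beta> F)\<^sup>2))
         \<le> C1 * C2 / (b\<^sup>2 * c) * (\<Sum>T\<in>\<T>. inverse (diameter T ^ 3) * (\<alpha> T)\<^sup>2)"
      by blast
  qed
qed

end
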